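(* Let $\mu\in\mathcal P$, let $y_d(\mu)\in W_d$ be the first component of the solution of the high fidelity problem and $y_{\mathrm{rb}}(\mu)\in W_L$ the first component of the solution of the reduced problem. Let $\tilde r_d(\mu)\in W_d$ be the Riesz representation of the discrete residual $r_d(\mu;\cdot)$, i.e. $(\tilde r_d(\mu),w_d)_{W_d}=r_d(\mu;w_d)$ for all $w_d\in W_d$. Then $$\|y_d(\mu)-y_{\mathrm{rb}}(\mu)\|_{W_d}\ \le\ \frac{\|\tilde r_d(\mu)\|_{W_d}}{\alpha(\mu)}=:\eta_\star^{\mathrm{abs}}(\mu).$$ Moreover, for $y_{\mathrm{rb}}(\mu)\neq0$, setting $$\eta_\star^{\mathrm{rel}}(\mu):=\frac{2\|\tilde r_d(\mu)\|_{W_d}}{\alpha(\mu)\,\|y_{\mathrm{rb}}(\mu)\|_{W_d}},$$ if $\eta_\star^{\mathrm{rel}}(\mu)\le 1$, then $$\frac{\|y_d(\mu)-y_{\mathrm{rb}}(\mu)\|_{W_d}}{\|y_d(\mu)\|_{W_d}}\ \le\ \eta_\star^{\mathrm{rel}}(\mu).$$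
   Context: Spaces and data. $V$ and $H$ are separable real Hilbert spaces with $V \hookrightarrow H\equiv H^\star \hookrightarrow V^\star$ a Gelfand triple; $\mathcal P$ is a parameter set. For each $\mu\in\mathcal P$, $a(\mu;\cdot,\cdot):V\times V\to\mathbb R$ is a symmetric bilinear form, and there are constants $c_s,c_c>0$ independent of $\mu$ with $|a(\mu;u,v)|\le c_s\|u\|_V\|v\|_V$ and $a(\mu;u,u)\ge c_c\|u\|_V^2$ for all $u,v\in V$. Write $(u,v)_{V(\mu)}:=a(\mu;u,v)$. A reference parameter $\overline\mu\in\mathcal P$ is fixed, and $V$ carries the inner product $(\cdot,\cdot)_V=a(\overline\mu;\cdot,\cdot)$. The operator $A(\mu):V\to V^\star$ is $\langle A(\mu)u,v\rangle_{V^\star,V}:=a(\mu;u,v)$. Let $T>0$, $W(0,T)=\{v\in L^2(0,T;V): v_t\in L^2(0,T;V^\star)\}$. Data: $y_0(\mu)\in H$ and $f(\mu)\in L^2(0,T;V^\star)$ with $\|f(\mu)\|_{L^2(0,T;V^\star)}$ bounded uniformly in $\mu$. Discrete spaces. Let $\psi_1,\dots,\psi_P\in L^2(0,T)$ be a basis of $J_P$, let $\chi_1,\dots,\chi_M\in H^1(0,T)$ with $(\chi_m)_t\in J_P$ be a basis of $K_M$, and let $\phi_1,\dots,\phi_N\in V$ be a basis of $V_N$. Set $Q_d=J_P\otimes V_N\subset L^2(0,T;V)$ and $W_d=K_M\otimes V_N\subset W(0,T)$, with bases $\psi_p\phi_n$ and $\chi_m\phi_n$ respectively. Coefficient vectors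 are ordered so that $\chi_m\phi_n$ (resp. $\psi_m\phi_n$) has index $(m-1)N+n$. Forms. For $y,w\in W(0,T)$, $p,q\in L^2(0,T;V)$: $\hat a(\mu;y,w)=(y(T),w(T))_H+\int_0^T(y,w)_{V(\mu)}$, $\hat b(w,q)=\int_0^T\langle w_t,q\rangle_{V^\star,V}$, $\hat c(\mu;p,q)=\int_0^T(p,q)_{V(\mu)}$, $\hat l_1(\mu;w)=(y_0(\mu),w(0))_H+\int_0^T\langle f(\mu),w\rangle_{V^\star,V}$, $\hat l_2(\mu;q)=\int_0^T\langle f(\mu),q\rangle_{V^\star,V}$. High fidelity problem. Find $(y_d,p_d)\in W_d\times Q_d$ with $\hat a(\mu;y_d,w_d)+\hat b(w_d,p_d)=\hat l_1(\mu;w_d)$ for all $w_d\in W_d$ and $\hat b(y_d,q_d)-\hat c(\mu;p_d,q_d)=\hat l_2(\mu;q_d)$ for all $q_d\in Q_d$. Reduced problem. $W_L=\mathrm{span}\{\xi_1,\dots,\xi_L\}\subset W_d$ with reduced basis $(\xi_l)_{l=1}^L$, and $B_W\in\mathbb R^{NM\times L}$ has as $l$-th column the coefficient vector of $\xi_l$ in the basis of $W_d$. $Q_K\subset Q_d$ is the span of the functions whose coefficient vectors in the basis of $Q_d$ are the columns of $B_Q:=(M_t^\psi\otimes A_x(\overline\mu))^{-1}(Z_t\otimes M_x)B_W$ (so $K=L$), where $(Z_t)_{ij}=\int_0^T(\chi_j)_t\psi_i$, $(M_t^\psi)_{ij}=\int_0^T\psi_j\psi_i$, $(M_x)_{ij}=(\phi_j,\phi_i)_H$,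 $(A_x(\mu))_{ij}=\langle A(\mu)\phi_j,\phi_i\rangle_{V^\star,V}$ and $\otimes$ is the Kronecker product. The reduced problem is: find $(y_{\mathrm{rb}},p_{\mathrm{rb}})\in W_L\times Q_K$ satisfying the two equations of the high fidelity problem with $W_d,Q_d$ replaced by $W_L,Q_K$ (for both trial and test functions). Norms and residual. The discrete Riesz lift $R_d(\mu):L^2(0,T;V^\star)\to Q_d$ is defined by $\int_0^T(R_d(\mu)\phi,q_d)_{V(\mu)}=\int_0^T\langle\phi,q_d\rangle_{V^\star,V}$ for all $q_d\in Q_d$. For $v_d,w_d\in W_d$, $$b_d(\mu;v_d,w_d):=\int_0^T(R_d(\mu)(v_d)_t,R_d(\mu)(w_d)_t)_{V(\mu)}+\int_0^T(v_d,w_d)_{V(\mu)}+(v_d(T),w_d(T))_H,$$ $$l_d(\mu;w_d):=(y_0(\mu),w_d(0))_H+\int_0^T\langle f(\mu),R_d(\mu)(w_d)_t\rangle_{V^\star,V}+\int_0^T\langle f(\mu),w_d\rangle_{V^\star,V}.$$ $W_d$ is equipped with $(v_d,w_d)_{W_d}:=b_d(\overline\mu;v_d,w_d)$ and $\|w_d\|_{W_d}:=(w_d,w_d)_{W_d}^{1/2}$. The discrete residual is $r_d(\mu;w_d):=l_d(\mu;w_d)-b_d(\mu;y_{\mathrm{rb}}(\mu),w_d)$, $w_d\in W_d$. Constants. $\mathfrak c_c(\mu):=\inf_{0\ne v\in V_N}\frac{a(\mu;v,v)}{\|v\|_V^2}$, $\mathfrak c_s(\mu):=\sup_{0\ne u\in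 V_N}\sup_{0\ne v\in V_N}\frac{a(\mu;u,v)}{\|u\|_V\|v\|_V}$, and $\alpha(\mu):=\min\{\mathfrak c_c(\mu),1/\mathfrak c_s(\mu)\}$. *)

theory Defs
  imports
    "HOL-Analysis.Analysis"
    "Jordan_Normal_Form.Gauss_Jordan_Elimination"
begin

text \<open>
  The Hilbert spaces \<open>V\<close> and \<open>H\<close> are types \<open>'v\<close>, \<open>'h\<close>; the dual \<open>V\<^sup>*\<close> is the type of bounded
  functionals on \<open>'v\<close>, and the duality pairing is application. The embedding of \<open>V\<close> into \<open>H\<close> is an
  explicit operator \<open>\<iota>\<close>; after identifying \<open>H\<close> with its dual, \<open>v \<in> V\<close> acts on \<open>V\<close> as
  \<open>\<lambda>u. inner (\<iota> v) (\<iota> u)\<close>.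

  Elements of \<open>L\<^sup>2(0,T;X)\<close> are represented by functions \<open>real \<Rightarrow> 'x\<close>, identified when equal almost
  everywhere on \<open>(0,T)\<close>.
\<close>

definition gelfand_triple ::
  "('v::{real_inner,complete_space} \<Rightarrow>\<^sub>L 'h::{real_inner,complete_space}) \<Rightarrow> bool" where
  "gelfand_triple \<iota> \<longleftrightarrow>
     inj (blinfun_apply \<iota>) \<and> closure (range (blinfun_apply \<iota>)) = UNIV"

text \<open>\<open>A\<close> is a form \<open>a(\<mu>;\<cdot>,\<cdot>)\<close>, and \<open>form_op A\<close> is the operator \<open>A(\<mu>): V \<rightarrow> V\<^sup>*\<close>.\<close>

definition form_op :: "('v::real_normed_vector \<Rightarrow> 'v \<Rightarrow> real) \<Rightarrow> 'v \<Rightarrow> ('v \<Rightarrow>\<^sub>L real)" where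
  "form_op A u = Blinfun (\<lambda>v. A u v)"


abbreviation time_meas :: "real \<Rightarrow> real measure" where
  "time_meas T \<equiv> lebesgue_on {0<..<T}"

text \<open>Borel measurability is strong (Bochner) measurability here: this is only used for \<open>X\<close> among
  \<open>\<real>\<close>, \<open>V\<close> and \<open>V\<^sup>*\<close>, which are separable when \<open>V\<close> is a separable Hilbert space.\<close>

definition L2 :: "real \<Rightarrow> (real \<Rightarrow> 'x::real_normed_vector) set" where
  "L2 T = {u. u \<in> borel_measurable (time_meas T) \<and>
              integrable (time_meas T) (\<lambda>t. (norm (u t))\<^sup>2)}"

definition L2_norm :: "real \<Rightarrow> (real \<Rightarrow> 'x::real_normed_vector) \<Rightarrow> real" where
  "L2_norm T u = sqrt (LINT t|time_meas T. (norm (u t))\<^sup>2)"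

text \<open>Linear independence and span of the first \<open>n\<close> functions of a family, as elements of
  \<open>L\<^sup>2(0,T;X)\<close>.\<close>

definition L2_independent ::
  "real \<Rightarrow> nat \<Rightarrow> (nat \<Rightarrow> real \<Rightarrow> 'x::real_normed_vector) \<Rightarrow> bool" where
  "L2_independent T n b \<longleftrightarrow>
     (\<forall>c. (AE t in time_meas T. (\<Sum>k<n. c k *\<^sub>R b k t) = 0) \<longrightarrow> (\<forall>k<n. c k = 0))"

definition L2_span ::
  "real \<Rightarrow> nat \<Rightarrow> (nat \<Rightarrow> real \<Rightarrow> 'x::real_normed_vector) \<Rightarrow> (real \<Rightarrow> 'x) set" where
  "L2_span T n b =
     {u \<in> L2 T. \<exists>c. AE t in time_meas T. u t = (\<Sum>k<n. c k *\<^sub>R b k t)}"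


text \<open>Weak derivatives on \<open>(0,T)\<close>, with compactly supported \<open>C\<^sup>1\<close> test functions (as in Brezis,
  Functional Analysis, Sobolev Spaces and PDE, Section 8.2).\<close>

definition test_functions :: "real \<Rightarrow> (real \<Rightarrow> real) set" where
  "test_functions T = {\<theta>. \<theta> C1_differentiable_on UNIV \<and>
     (\<exists>K. compact K \<and> K \<subseteq> {0<..<T} \<and> (\<forall>t. t \<notin> K \<longrightarrow> \<theta> t = 0))}"

definition has_weak_deriv :: "real \<Rightarrow> (real \<Rightarrow> real) \<Rightarrow> (real \<Rightarrow> real) \<Rightarrow> bool" where
  "has_weak_deriv T u g \<longleftrightarrow>
     (\<forall>\<theta>\<in>test_functions T.
        (LINT t|time_meas T. u t * deriv \<theta> t) = - (LINT t|time_meas T. g t * \<theta> t))"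

definition H1 :: "real \<Rightarrow> (real \<Rightarrow> real) set" where
  "H1 T = {u \<in> L2 T. \<exists>g\<in>L2 T. has_weak_deriv T u g}"

definition weak_deriv :: "real \<Rightarrow> (real \<Rightarrow> real) \<Rightarrow> real \<Rightarrow> real" where
  "weak_deriv T u = (SOME g. g \<in> L2 T \<and> has_weak_deriv T u g)"

text \<open>The \<open>V\<^sup>*\<close>-valued identity defining \<open>u\<^sub>t\<close> is stated by pairing with each \<open>v \<in> V\<close>, since the
  library's Bochner integral is not available on the type of functionals.\<close>

definition has_time_deriv ::
  "real \<Rightarrow> ('v::real_normed_vector \<Rightarrow>\<^sub>L 'h::real_inner) \<Rightarrow> (real \<Rightarrow> 'v) \<Rightarrow>
   (real \<Rightarrow> 'v \<Rightarrow>\<^sub>L real) \<Rightarrow> bool" where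
  "has_time_deriv T \<iota> u g \<longleftrightarrow>
     (\<forall>v. has_weak_deriv T (\<lambda>t. inner (\<iota> (u t)) (\<iota> v)) (\<lambda>t. g t v))"

text \<open>The domain \<open>W(0,T)\<close> of the forms below.\<close>

definition W_space ::
  "real \<Rightarrow> ('v::real_normed_vector \<Rightarrow>\<^sub>L 'h::real_inner) \<Rightarrow> (real \<Rightarrow> 'v) set" where
  "W_space T \<iota> = {u \<in> L2 T. \<exists>g\<in>L2 T. has_time_deriv T \<iota> u g}"

definition time_deriv ::
  "real \<Rightarrow> ('v::real_normed_vector \<Rightarrow>\<^sub>L 'h::real_inner) \<Rightarrow> (real \<Rightarrow> 'v) \<Rightarrow>
   real \<Rightarrow> 'v \<Rightarrow>\<^sub>L real" where
  "time_deriv T \<iota> u = (SOME g. g \<in> L2 T \<and> has_time_deriv T \<iota> u g)"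

text \<open>Point values of elements of \<open>W(0,T)\<close> are those of the representative in \<open>C([0,T];H)\<close>, which
  is unique on \<open>[0,T]\<close>.\<close>

definition trace_at ::
  "real \<Rightarrow> ('v::real_normed_vector \<Rightarrow>\<^sub>L 'h::real_inner) \<Rightarrow> (real \<Rightarrow> 'v) \<Rightarrow> real \<Rightarrow> 'h" where
  "trace_at T \<iota> u =
     (SOME c. continuous_on {0..T} c \<and> (AE t in time_meas T. c t = \<iota> (u t)))"


text \<open>The basis functions \<open>\<chi>\<^sub>m \<phi>\<^sub>n\<close>; counting from 0, the pair \<open>(m,n)\<close> has index \<open>m * N + n\<close>.\<close>

definition tensor_basis ::
  "nat \<Rightarrow> (nat \<Rightarrow> real \<Rightarrow> real) \<Rightarrow> (nat \<Rightarrow> 'v::real_normed_vector) \<Rightarrow> nat \<Rightarrow> real \<Rightarrow> 'v" where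
  "tensor_basis N b \<phi> k t = b (k div N) t *\<^sub>R \<phi> (k mod N)"

definition tensor_space ::
  "real \<Rightarrow> nat \<Rightarrow> nat \<Rightarrow> (nat \<Rightarrow> real \<Rightarrow> real) \<Rightarrow> (nat \<Rightarrow> 'v::real_normed_vector) \<Rightarrow>
   (real \<Rightarrow> 'v) set" where
  "tensor_space T M N b \<phi> = L2_span T (M * N) (tensor_basis N b \<phi>)"


definition a_hat ::
  "real \<Rightarrow> ('v::real_normed_vector \<Rightarrow>\<^sub>L 'h::real_inner) \<Rightarrow> ('v \<Rightarrow> 'v \<Rightarrow> real) \<Rightarrow>
   (real \<Rightarrow> 'v) \<Rightarrow> (real \<Rightarrow> 'v) \<Rightarrow> real" where
  "a_hat T \<iota> A y w =
     inner (trace_at T \<iota> y T) (trace_at T \<iota> w T) + (LINT t|time_meas T. A (y t) (w t))"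

definition b_hat ::
  "real \<Rightarrow> ('v::real_normed_vector \<Rightarrow>\<^sub>L 'h::real_inner) \<Rightarrow>
   (real \<Rightarrow> 'v) \<Rightarrow> (real \<Rightarrow> 'v) \<Rightarrow> real" where
  "b_hat T \<iota> w q = (LINT t|time_meas T. time_deriv T \<iota> w t (q t))"

definition c_hat ::
  "real \<Rightarrow> ('v \<Rightarrow> 'v \<Rightarrow> real) \<Rightarrow> (real \<Rightarrow> 'v) \<Rightarrow> (real \<Rightarrow> 'v) \<Rightarrow> real" where
  "c_hat T A p q = (LINT t|time_meas T. A (p t) (q t))"

definition l1_hat ::
  "real \<Rightarrow> ('v::real_normed_vector \<Rightarrow>\<^sub>L 'h::real_inner) \<Rightarrow> 'h \<Rightarrow> (real \<Rightarrow> 'v \<Rightarrow>\<^sub>L real) \<Rightarrow>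
   (real \<Rightarrow> 'v) \<Rightarrow> real" where
  "l1_hat T \<iota> y0 f w =
     inner y0 (trace_at T \<iota> w 0) + (LINT t|time_meas T. f t (w t))"

definition l2_hat ::
  "real \<Rightarrow> (real \<Rightarrow> 'v::real_normed_vector \<Rightarrow>\<^sub>L real) \<Rightarrow> (real \<Rightarrow> 'v) \<Rightarrow> real" where
  "l2_hat T f q = (LINT t|time_meas T. f t (q t))"

text \<open>The saddle point problem on \<open>W \<times> Q\<close>, for trial and test functions alike.\<close>

definition solves_problem ::
  "real \<Rightarrow> ('v::real_normed_vector \<Rightarrow>\<^sub>L 'h::real_inner) \<Rightarrow> ('v \<Rightarrow> 'v \<Rightarrow> real) \<Rightarrow>
   'h \<Rightarrow> (real \<Rightarrow> 'v \<Rightarrow>\<^sub>L real) \<Rightarrow> (real \<Rightarrow> 'v) set \<Rightarrow> (real \<Rightarrow> 'v) set \<Rightarrow>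
   (real \<Rightarrow> 'v) \<Rightarrow> (real \<Rightarrow> 'v) \<Rightarrow> bool" where
  "solves_problem T \<iota> A y0 f W Q y p \<longleftrightarrow>
     y \<in> W \<and> p \<in> Q \<and>
     (\<forall>w\<in>W. a_hat T \<iota> A y w + b_hat T \<iota> w p = l1_hat T \<iota> y0 f w) \<and>
     (\<forall>q\<in>Q. b_hat T \<iota> y q - c_hat T A p q = l2_hat T f q)"


definition kronecker :: "real mat \<Rightarrow> real mat \<Rightarrow> real mat" where
  "kronecker X Y = Matrix.mat (dim_row X * dim_row Y) (dim_col X * dim_col Y)
     (\<lambda>(i,j). X $$ (i div dim_row Y, j div dim_col Y) * Y $$ (i mod dim_row Y, j mod dim_col Y))"

definition Z_mat ::
  "real \<Rightarrow> nat \<Rightarrow> nat \<Rightarrow> (nat \<Rightarrow> real \<Rightarrow> real) \<Rightarrow> (nat \<Rightarrow> real \<Rightarrow> real) \<Rightarrow> real mat" where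
  "Z_mat T P M \<psi> chi =
     Matrix.mat P M (\<lambda>(i,j). LINT t|time_meas T. weak_deriv T (chi j) t * \<psi> i t)"

definition time_mass_mat :: "real \<Rightarrow> nat \<Rightarrow> (nat \<Rightarrow> real \<Rightarrow> real) \<Rightarrow> real mat" where
  "time_mass_mat T P \<psi> = Matrix.mat P P (\<lambda>(i,j). LINT t|time_meas T. \<psi> j t * \<psi> i t)"

definition space_mass_mat ::
  "('v::real_normed_vector \<Rightarrow>\<^sub>L 'h::real_inner) \<Rightarrow> nat \<Rightarrow> (nat \<Rightarrow> 'v) \<Rightarrow> real mat" where
  "space_mass_mat \<iota> N \<phi> = Matrix.mat N N (\<lambda>(i,j). inner (\<iota> (\<phi> j)) (\<iota> (\<phi> i)))"

definition stiffness_mat ::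
  "('v::real_normed_vector \<Rightarrow> 'v \<Rightarrow> real) \<Rightarrow> nat \<Rightarrow> (nat \<Rightarrow> 'v) \<Rightarrow> real mat" where
  "stiffness_mat A N \<phi> = Matrix.mat N N (\<lambda>(i,j). form_op A (\<phi> j) (\<phi> i))"

text \<open>\<open>A\<close> is the reference form here. The matrix that is inverted is symmetric positive definite, so
  \<open>the\<close> is applied to a proper value.\<close>

definition BQ_mat ::
  "real \<Rightarrow> ('v::real_normed_vector \<Rightarrow>\<^sub>L 'h::real_inner) \<Rightarrow> ('v \<Rightarrow> 'v \<Rightarrow> real) \<Rightarrow>
   nat \<Rightarrow> nat \<Rightarrow> nat \<Rightarrow> (nat \<Rightarrow> real \<Rightarrow> real) \<Rightarrow> (nat \<Rightarrow> real \<Rightarrow> real) \<Rightarrow> (nat \<Rightarrow> 'v) \<Rightarrow>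
   real mat \<Rightarrow> real mat" where
  "BQ_mat T \<iota> A P M N \<psi> chi \<phi> BW =
     the (mat_inverse (kronecker (time_mass_mat T P \<psi>) (stiffness_mat A N \<phi>)))
       * kronecker (Z_mat T P M \<psi> chi) (space_mass_mat \<iota> N \<phi>) * BW"

text \<open>The function whose coefficient vector in the basis \<open>e\<^sub>0, \<dots>, e\<^sub>n\<^sub>-\<^sub>1\<close> is the \<open>l\<close>-th column of \<open>B\<close>.\<close>

definition column_function ::
  "nat \<Rightarrow> (nat \<Rightarrow> real \<Rightarrow> 'v::real_normed_vector) \<Rightarrow> real mat \<Rightarrow> nat \<Rightarrow> real \<Rightarrow> 'v" where
  "column_function n e B l t = (\<Sum>k<n. B $$ (k, l) *\<^sub>R e k t)"


text \<open>In the following, \<open>Q\<close> is the discrete space \<open>Q\<^sub>d\<close> and \<open>A\<close> the form \<open>a(\<mu>;\<cdot>,\<cdot>)\<close>. The Riesz lift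
  is unique as an element of \<open>L\<^sup>2(0,T;V)\<close>.\<close>

definition riesz_lift ::
  "real \<Rightarrow> (real \<Rightarrow> 'v::real_normed_vector) set \<Rightarrow> ('v \<Rightarrow> 'v \<Rightarrow> real) \<Rightarrow>
   (real \<Rightarrow> 'v \<Rightarrow>\<^sub>L real) \<Rightarrow> real \<Rightarrow> 'v" where
  "riesz_lift T Q A g =
     (SOME r. r \<in> Q \<and>
        (\<forall>q\<in>Q. (LINT t|time_meas T. A (r t) (q t)) = (LINT t|time_meas T. g t (q t))))"

definition b_disc ::
  "real \<Rightarrow> ('v::real_normed_vector \<Rightarrow>\<^sub>L 'h::real_inner) \<Rightarrow> (real \<Rightarrow> 'v) set \<Rightarrow>
   ('v \<Rightarrow> 'v \<Rightarrow> real) \<Rightarrow> (real \<Rightarrow> 'v) \<Rightarrow> (real \<Rightarrow> 'v) \<Rightarrow> real" where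
  "b_disc T \<iota> Q A v w =
     (LINT t|time_meas T.
        A (riesz_lift T Q A (time_deriv T \<iota> v) t) (riesz_lift T Q A (time_deriv T \<iota> w) t))
     + (LINT t|time_meas T. A (v t) (w t))
     + inner (trace_at T \<iota> v T) (trace_at T \<iota> w T)"

definition l_disc ::
  "real \<Rightarrow> ('v::real_normed_vector \<Rightarrow>\<^sub>L 'h::real_inner) \<Rightarrow> (real \<Rightarrow> 'v) set \<Rightarrow>
   ('v \<Rightarrow> 'v \<Rightarrow> real) \<Rightarrow> 'h \<Rightarrow> (real \<Rightarrow> 'v \<Rightarrow>\<^sub>L real) \<Rightarrow> (real \<Rightarrow> 'v) \<Rightarrow> real" where
  "l_disc T \<iota> Q A y0 f w =
     inner y0 (trace_at T \<iota> w 0)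
     + (LINT t|time_meas T. f t (riesz_lift T Q A (time_deriv T \<iota> w) t))
     + (LINT t|time_meas T. f t (w t))"

definition res_disc ::
  "real \<Rightarrow> ('v::real_normed_vector \<Rightarrow>\<^sub>L 'h::real_inner) \<Rightarrow> (real \<Rightarrow> 'v) set \<Rightarrow>
   ('v \<Rightarrow> 'v \<Rightarrow> real) \<Rightarrow> 'h \<Rightarrow> (real \<Rightarrow> 'v \<Rightarrow>\<^sub>L real) \<Rightarrow> (real \<Rightarrow> 'v) \<Rightarrow> (real \<Rightarrow> 'v) \<Rightarrow> real" where
  "res_disc T \<iota> Q A y0 f y w = l_disc T \<iota> Q A y0 f w - b_disc T \<iota> Q A y w"

text \<open>For the inner product and the norm of \<open>W\<^sub>d\<close> the form \<open>A\<close> is the reference form.\<close>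

definition Wd_norm ::
  "real \<Rightarrow> ('v::real_normed_vector \<Rightarrow>\<^sub>L 'h::real_inner) \<Rightarrow> (real \<Rightarrow> 'v) set \<Rightarrow>
   ('v \<Rightarrow> 'v \<Rightarrow> real) \<Rightarrow> (real \<Rightarrow> 'v) \<Rightarrow> real" where
  "Wd_norm T \<iota> Q A w = sqrt (b_disc T \<iota> Q A w w)"


definition coercivity_const :: "'v::real_normed_vector set \<Rightarrow> ('v \<Rightarrow> 'v \<Rightarrow> real) \<Rightarrow> real" where
  "coercivity_const U A = (INF v\<in>U - {0}. A v v / (norm v)\<^sup>2)"

definition continuity_const :: "'v::real_normed_vector set \<Rightarrow> ('v \<Rightarrow> 'v \<Rightarrow> real) \<Rightarrow> real" where
  "continuity_const U A = (SUP u\<in>U - {0}. SUP v\<in>U - {0}. A u v / (norm u * norm v))"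

definition alpha_const :: "'v::real_normed_vector set \<Rightarrow> ('v \<Rightarrow> 'v \<Rightarrow> real) \<Rightarrow> real" where
  "alpha_const U A = min (coercivity_const U A) (1 / continuity_const U A)"

end

theory Submission
  imports Defs
begin

text \<open>
  Testing the second equation of the saddle point problem with the Riesz lift of \<open>w\<^sub>t\<close> eliminates the
  multiplier, so \<open>y\<^sub>d\<close> satisfies \<open>b\<^sub>d(\<mu>; y\<^sub>d, w) = l\<^sub>d(\<mu>; w)\<close>. Hence the error \<open>e = y\<^sub>d - y\<^sub>r\<^sub>b\<close> satisfies
  \<open>b\<^sub>d(\<mu>; e, w) = (r, w)\<close> with \<open>r\<close> the representative of the residual, and
  \<open>\<alpha>(\<mu>) \<parallel>e\<parallel>\<^sup>2 \<le> b\<^sub>d(\<mu>; e, e) = (r, e) \<le> \<parallel>r\<parallel> \<parallel>e\<parallel>\<close>. The lift term of \<open>b\<^sub>d\<close> is a dual norm with respect to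
  \<open>a(\<mu>; \<cdot>, \<cdot>)\<close>, which accounts for \<open>1 / c\<^sub>s(\<mu>)\<close> in \<open>\<alpha>(\<mu>)\<close>. The relative bound follows because
  \<open>\<eta> \<le> 1\<close> gives \<open>\<parallel>e\<parallel> \<le> \<parallel>y\<^sub>r\<^sub>b\<parallel> / 2\<close>, hence \<open>\<parallel>y\<^sub>d\<parallel> \<ge> \<parallel>y\<^sub>r\<^sub>b\<parallel> / 2\<close>.

  Time derivatives, traces and lifts are chosen representatives. Their linearity, needed for
  \<open>b\<^sub>d(\<mu>; y\<^sub>d, w) - b\<^sub>d(\<mu>; y\<^sub>r\<^sub>b, w) = b\<^sub>d(\<mu>; e, w)\<close>, rests on existence and on uniqueness almost everywhere:
  for weak derivatives by the fundamental lemma of the calculus of variations, for traces by the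
  continuous representative of an \<open>H\<^sup>1\<close> function, for lifts by solving the Gram system.
\<close>

section \<open>Weak derivatives on an interval\<close>

lemma finite_measure_time_meas [simp]: "finite_measure (time_meas T)"
  by (rule finite_measure_lebesgue_on) simp

lemma integrable_const_time_meas [simp]: "integrable (time_meas T) (\<lambda>t. c :: real)"
  by (rule finite_measure.integrable_const[OF finite_measure_time_meas])

lemma borel_imp_time_measurable:
  "u \<in> borel_measurable borel \<Longrightarrow> u \<in> borel_measurable (time_meas T)"
  by (intro measurable_restrict_space1 measurable_completion) simp

text \<open>By Lebesgue differentiation the means of \<open>h\<close> over \<open>(x, x + k)\<close>
  tend to \<open>h x\<close> for almost every \<open>x\<close>, and here every such mean is
  zero.\<close>

lemma AE_zero_if_interval_integrals_zero:
  fixes h :: "real \<Rightarrow> real"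
  assumes h: "integrable (time_meas T) h"
    and zero: "\<And>a b. 0 < a \<Longrightarrow> a < b \<Longrightarrow> b < T \<Longrightarrow>
      (LINT t|time_meas T. indicator {a<..<b} t * h t) = 0"
  shows "AE t in time_meas T. h t = 0"
proof -
  \<comment> \<open>\<open>F\<close> extends \<open>h\<close> by zero, so that it is integrable on
    every box of the line, as the differentiation theorem asks.\<close>
  define F where "F t = (if t \<in> {0<..<T} then h t else 0)" for t
  have "integrable lebesgue F"
  proof -
    have "F = (\<lambda>t. indicator {0<..<T} t *\<^sub>R h t)" by (auto simp: F_def)
    then show ?thesis using h by (simp add: integrable_restrict_space)
  qed
  then have intF: "F integrable_on cbox a b" for a b
    by (intro integrable_on_lebesgue_on)
      (auto simp: integrable_restrict_space simp flip: real_scaleR_def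
        intro!: integrable_mult_indicator)
  obtain N where N: "negligible N"
    "\<And>x e. \<lbrakk>x \<notin> N; 0 < e\<rbrakk> \<Longrightarrow> \<exists>d>0. \<forall>k. 0 < k \<and> k < d \<longrightarrow>
        norm (integral (cbox x (x + k *\<^sub>R One)) F /\<^sub>R k ^ DIM(real) - F x) < e"
    using integrable_ccontinuous_explicit[OF intF] by metis
  have "h x = 0" if x: "x \<in> {0<..<T}" "x \<notin> N" for x
  proof (rule ccontr)
    assume "h x \<noteq> 0"
    with N(2)[OF x(2), of "\<bar>h x\<bar>"] obtain d where d: "d > 0"
      "\<And>k. 0 < k \<and> k < d \<Longrightarrow> \<bar>integral {x..x+k} F / k - F x\<bar> < \<bar>h x\<bar>"
      by (auto simp: divide_inverse mult.commute)
    \<comment> \<open>Halving both bounds keeps \<open>k\<close> below \<open>d\<close> and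
      \<open>x + k\<close> strictly below \<open>T\<close>.\<close>
    define k where "k = min (d/2) ((T - x)/2)"
    have k: "0 < k" "k < d" "x + k < T" using d x by (auto simp: k_def min_def field_simps)
    have "integral {x..x+k} F = integral {x<..<x+k} F"
      by (simp add: integral_open_interval_real)
    also have "\<dots> = integral {x<..<x+k} h"
      using x k by (intro integral_cong) (auto simp: F_def)
    also have "\<dots> = (LINT t|lebesgue_on {x<..<x+k}. h t)"
    proof (rule lebesgue_integral_eq_integral[symmetric])
      have "integrable lebesgue (\<lambda>t. indicator {x<..<x+k} t *\<^sub>R (indicator {0<..<T} t *\<^sub>R h t))"
        using h by (intro integrable_mult_indicator[of "{x<..<x+k}"]) (auto simp: integrable_restrict_space)
      moreover have "(\<lambda>t. indicator {x<..<x+k} t *\<^sub>R (indicator {0<..<T} t *\<^sub>R h t))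
          = (\<lambda>t. indicator {x<..<x+k} t *\<^sub>R h t)"
        using x k by (auto simp: indicator_def)
      ultimately show "integrable (lebesgue_on {x<..<x+k}) h"
        by (simp add: integrable_restrict_space)
    qed simp
    also have "\<dots> = (LINT t|time_meas T. indicator {x<..<x+k} t * h t)"
      using x k by (auto simp: integral_restrict_space indicator_def intro!: Bochner_Integration.integral_cong)
    also have "\<dots> = 0" using zero[of x "x+k"] x k by simp
    finally show False using d(2)[of k] k x by (simp add: F_def)
  qed
  moreover have "AE x in time_meas T. x \<notin> N"
    using AE_not_in[of N lebesgue] N(1)
    by (auto simp: AE_restrict_space_iff negligible_iff_null_sets elim!: eventually_mono)
  ultimately show ?thesis
    by (auto simp: AE_restrict_space_iff elim!: eventually_mono)
qed

section \<open>Bump functions and test functions\<close>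

text \<open>Squaring smooths the kink of the positive part: at 0 the difference quotient is at most
  \<open>\<bar>h\<bar>\<close>. This makes \<open>bump\<close> continuously differentiable at the
  ends of its support.\<close>

lemma has_field_derivative_max0_power2:
  "((\<lambda>x::real. (max 0 x)\<^sup>2) has_field_derivative 2 * max 0 x) (at x)"
proof -
  consider "x > 0" | "x < 0" | "x = 0" by linarith
  then show ?thesis
  proof cases
    case 1
    have "((\<lambda>x::real. x\<^sup>2) has_field_derivative 2 * max 0 x) (at x)"
      using 1 by (auto intro!: derivative_eq_intros)
    then show ?thesis
      by (rule has_field_derivative_transform_within_open[of _ _ _ "{0<..}"]) (use 1 in auto)
  next
    case 2
    have "((\<lambda>x::real. 0) has_field_derivative 2 * max 0 x) (at x)"
      using 2 by (auto intro!: derivative_eq_intros)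
    then show ?thesis
      by (rule has_field_derivative_transform_within_open[of _ _ _ "{..<0}"]) (use 2 in auto)
  next
    case 3
    have "((\<lambda>h::real. (max 0 h)\<^sup>2 / h) \<longlongrightarrow> 0) (at 0)"
    proof (rule Lim_null_comparison)
      show "eventually (\<lambda>h. norm ((max 0 h)\<^sup>2 / h) \<le> \<bar>h\<bar>) (at (0::real))"
        by (auto simp: max_def power2_eq_square)
      show "(abs \<longlongrightarrow> 0) (at (0::real))"
        by (auto intro!: tendsto_eq_intros)
    qed
    then show ?thesis using 3 by (simp add: DERIV_def)
  qed
qed

text \<open>\<open>C\<^sup>1\<close> functions supported in \<open>[a,b]\<close> that increase to the indicator of \<open>(a,b)\<close> with \<open>n\<close>.\<close>

definition bump :: "real \<Rightarrow> real \<Rightarrow> nat \<Rightarrow> real \<Rightarrow> real" where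
  "bump a b n t = (let q = real n * (max 0 ((t - a) * (b - t)))\<^sup>2 in q / (1 + q))"

lemma bump_C1: "bump a b n C1_differentiable_on UNIV"
proof -
  define q where "q t = real n * (max 0 ((t - a) * (b - t)))\<^sup>2" for t
  define q' where "q' t = real n * (2 * max 0 ((t - a) * (b - t)) * (a + b - 2 * t))" for t
  have q: "(q has_field_derivative q' t) (at t)" for t
    unfolding q_def[abs_def] q'_def
    by (rule DERIV_cmult DERIV_chain2[OF has_field_derivative_max0_power2])+
       (auto intro!: derivative_eq_intros simp: algebra_simps)
  have nz: "1 + q t \<noteq> 0" for t
  proof -
    have "q t \<ge> 0" by (simp add: q_def)
    then show ?thesis by linarith
  qed
  have "((\<lambda>t. q t / (1 + q t)) has_field_derivative (q' t * (1 + q t) - q t * q' t) / ((1 + q t) * (1 + q t))) (at t)" for t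
    using nz[of t] by (auto intro!: derivative_eq_intros q)
  moreover have "continuous_on UNIV (\<lambda>t. (q' t * (1 + q t) - q t * q' t) / ((1 + q t) * (1 + q t)))"
    using nz by (intro continuous_intros) (auto simp: q_def[abs_def] q'_def[abs_def] intro!: continuous_intros)
  ultimately show ?thesis
    unfolding C1_differentiable_on_def bump_def[abs_def] Let_def q_def[symmetric]
    unfolding has_real_derivative_iff_has_vector_derivative by fast
qed

lemma bump_bounds: "0 \<le> bump a b n t" "bump a b n t \<le> 1"
proof -
  have "0 \<le> real n * (max 0 ((t - a) * (b - t)))\<^sup>2" by simp
  moreover from this have "\<not> 1 + real n * (max 0 ((t - a) * (b - t)))\<^sup>2 < 0" by linarith
  ultimately show "0 \<le> bump a b n t" "bump a b n t \<le> 1"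
    unfolding bump_def Let_def by (simp_all add: divide_le_eq)
qed

lemma bump_outside: "a < b \<Longrightarrow> t \<notin> {a<..<b} \<Longrightarrow> bump a b n t = 0"
  by (auto simp: bump_def max_def not_less mult_le_0_iff zero_le_mult_iff)

lemma bump_pos:
  assumes "n > 0" "t \<in> {a<..<b}"
  shows "bump a b n t > 0"
proof -
  have "(t - a) * (b - t) > 0" using assms by simp
  then have "real n * (max 0 ((t - a) * (b - t)))\<^sup>2 > 0" using assms by (simp add: max_def)
  then show ?thesis by (simp add: bump_def Let_def add_pos_pos del: mult_pos_pos)
qed

text \<open>Inside the interval the value is \<open>1 - 1 / (1 + n * q)\<close> with a fixed
  \<open>q > 0\<close>, which tends to 1; outside it is constantly 0.\<close>

lemma bump_tendsto:
  assumes "a < b"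
  shows "(\<lambda>n. bump a b n t) \<longlonglongrightarrow> indicator {a<..<b} t"
proof (cases "t \<in> {a<..<b}")
  case True
  then have "(t - a) * (b - t) > 0" by simp
  then have "max 0 ((t - a) * (b - t)) > 0" by (simp add: max_def)
  then have q: "(max 0 ((t - a) * (b - t)))\<^sup>2 > 0" (is "?q > 0") by (rule zero_less_power)
  have "filterlim (\<lambda>n. 1 + real n * ?q) at_top sequentially"
    by (intro filterlim_tendsto_add_at_top[OF tendsto_const]
        filterlim_at_top_mult_tendsto_pos[OF tendsto_const q] filterlim_real_sequentially)
  then have "(\<lambda>n. 1 - 1 / (1 + real n * ?q)) \<longlonglongrightarrow> 1 - 0"
    by (intro tendsto_intros real_tendsto_divide_at_top[OF tendsto_const])
  moreover have "bump a b n t = 1 - 1 / (1 + real n * ?q)" for n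
  proof -
    have "0 \<le> real n * ?q" by simp
    then have "1 + real n * ?q \<noteq> 0" by linarith
    then show ?thesis by (simp add: bump_def Let_def field_simps)
  qed
  ultimately show ?thesis using True by simp
next
  case False
  then show ?thesis using bump_outside[OF assms False] by simp
qed

lemma bump_test_function:
  assumes "0 < a" "a < b" "b < T"
  shows "bump a b n \<in> test_functions T"
  unfolding test_functions_def
  using assms bump_C1 bump_outside[OF assms(2)]
  by (intro CollectI conjI exI[of _ "{a..b}"]) auto

lemma test_function_continuous:
  assumes "\<theta> \<in> test_functions T"
  shows "continuous_on UNIV \<theta>" "continuous_on UNIV (deriv \<theta>)"
    "\<And>t. (\<theta> has_field_derivative deriv \<theta> t) (at t)"
proof -
  obtain D where D: "\<And>t. (\<theta> has_vector_derivative D t) (at t)" "continuous_on UNIV D"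
    using assms by (auto simp: test_functions_def C1_differentiable_on_def)
  have *: "(\<theta> has_field_derivative D t) (at t)" for t
    using D by (simp add: has_real_derivative_iff_has_vector_derivative)
  then have "deriv \<theta> = D" by (auto intro: DERIV_imp_deriv)
  with D * show "continuous_on UNIV (deriv \<theta>)"
    "\<And>t. (\<theta> has_field_derivative deriv \<theta> t) (at t)" by auto
  show "continuous_on UNIV \<theta>"
    using * by (auto intro!: DERIV_isCont simp: continuous_on_eq_continuous_at)
qed

lemma test_function_support:
  assumes "\<theta> \<in> test_functions T"
  obtains a b where "0 < a" "a < b" "b < T" "\<And>t. t \<notin> {a..b} \<Longrightarrow> \<theta> t = 0"
  | "\<And>t. \<theta> t = 0"
proof -
  obtain K where K: "compact K" "K \<subseteq> {0<..<T}" "\<And>t. t \<notin> K \<Longrightarrow> \<theta> t = 0"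
    using assms by (auto simp: test_functions_def)
  show ?thesis
  proof (cases "K = {}")
    case True
    with K that(2) show ?thesis by auto
  next
    case False
    then obtain x y where xy: "x \<in> K" "y \<in> K" "\<And>t. t \<in> K \<Longrightarrow> x \<le> t \<and> t \<le> y"
      using compact_attains_inf[OF K(1)] compact_attains_sup[OF K(1)] by metis
    then have "0 < x" "x \<le> y" "y < T" using K by auto
    show ?thesis
    \<comment> \<open>The right end is moved to the midpoint of \<open>y\<close> and
      \<open>T\<close>, since \<open>x = y\<close> is possible and the interval has to be
      nondegenerate.\<close>
    proof (rule that(1)[of x "(y+T)/2"])
      fix t assume "t \<notin> {x..(y+T)/2}"
      then have "t \<notin> K" using xy(3)[of t] \<open>y < T\<close> by auto
      then show "\<theta> t = 0" by (rule K)
    qed (use \<open>0 < x\<close> \<open>x \<le> y\<close> \<open>y < T\<close> in auto)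
  qed
qed

lemma test_function_bounded:
  assumes "\<theta> \<in> test_functions T"
  shows "\<exists>B. \<forall>t\<in>{0<..<T}. \<bar>\<theta> t\<bar> \<le> B" "\<exists>B. \<forall>t\<in>{0<..<T}. \<bar>deriv \<theta> t\<bar> \<le> B"
proof -
  have "\<exists>B. \<forall>t\<in>{0<..<T}. \<bar>g t\<bar> \<le> B" if "continuous_on UNIV g" for g :: "real \<Rightarrow> real"
  proof -
    have "compact (g ` {0..T})"
      by (intro compact_continuous_image continuous_on_subset[OF that]) auto
    then obtain B where "\<forall>x\<in>g ` {0..T}. norm x \<le> B"
      using compact_imp_bounded bounded_iff by metis
    then show ?thesis by (auto intro!: exI[of _ B])
  qed
  then show "\<exists>B. \<forall>t\<in>{0<..<T}. \<bar>\<theta> t\<bar> \<le> B" "\<exists>B. \<forall>t\<in>{0<..<T}. \<bar>deriv \<theta> t\<bar> \<le> B"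
    using test_function_continuous[OF assms] by auto
qed

lemma integrable_mult_continuous:
  fixes u g :: "real \<Rightarrow> real"
  assumes "integrable (time_meas T) u" "continuous_on UNIV g" "\<exists>B. \<forall>t\<in>{0<..<T}. \<bar>g t\<bar> \<le> B"
  shows "integrable (time_meas T) (\<lambda>t. u t * g t)"
proof -
  obtain B where B: "\<forall>t\<in>{0<..<T}. \<bar>g t\<bar> \<le> B" using assms by auto
  have g: "g \<in> borel_measurable (time_meas T)"
    by (intro borel_imp_time_measurable borel_measurable_continuous_onI assms)
  show ?thesis
  proof (rule Bochner_Integration.integrable_bound[where f="\<lambda>t. B * u t"])
    show "integrable (time_meas T) (\<lambda>t. B * u t)" using assms(1) by simp
    show "(\<lambda>t. u t * g t) \<in> borel_measurable (time_meas T)" using g assms(1) by simp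
    show "AE t in time_meas T. norm (u t * g t) \<le> norm (B * u t)"
    proof (rule AE_I2)
      fix t assume "t \<in> space (time_meas T)"
      then have "\<bar>g t\<bar> * \<bar>u t\<bar> \<le> \<bar>B\<bar> * \<bar>u t\<bar>" using B by (intro mult_right_mono) force+
      then show "norm (u t * g t) \<le> norm (B * u t)" by (simp add: abs_mult mult.commute)
    qed
  qed
qed

section \<open>Functions with vanishing test integrals\<close>

text \<open>Bumps are test functions bounded by 1 that converge to the indicator of an interval, so
  dominated convergence makes every interval integral of \<open>h\<close> vanish.\<close>

lemma fundamental_lemma_calculus_of_variations:
  fixes h :: "real \<Rightarrow> real"
  assumes h: "integrable (time_meas T) h"
    and zero: "\<And>\<theta>. \<theta> \<in> test_functions T \<Longrightarrow> (LINT t|time_meas T. h t * \<theta> t) = 0"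
  shows "AE t in time_meas T. h t = 0"
proof (rule AE_zero_if_interval_integrals_zero[OF h])
  fix a b :: real assume ab: "0 < a" "a < b" "b < T"
  have "(\<lambda>n. LINT t|time_meas T. h t * bump a b n t)
      \<longlonglongrightarrow> (LINT t|time_meas T. h t * indicator {a<..<b} t)"
  proof (rule integral_dominated_convergence[where w="\<lambda>t. \<bar>h t\<bar>"])
    show "integrable (time_meas T) (\<lambda>t. \<bar>h t\<bar>)" using h by simp
    have "bump a b n \<in> borel_measurable (time_meas T)" for n
      using bump_test_function[OF ab]
      by (intro borel_imp_time_measurable borel_measurable_continuous_onI test_function_continuous(1))
    then show "(\<lambda>t. h t * bump a b n t) \<in> borel_measurable (time_meas T)" for n
      using h by measurable
    show "(\<lambda>t. h t * indicator {a<..<b} t) \<in> borel_measurable (time_meas T)"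
      by (intro borel_measurable_times borel_measurable_integrable[OF h] borel_imp_time_measurable) auto
    show "AE t in time_meas T. (\<lambda>n. h t * bump a b n t) \<longlonglongrightarrow> h t * indicator {a<..<b} t"
      by (intro AE_I2 tendsto_mult tendsto_const bump_tendsto ab)
    show "AE t in time_meas T. norm (h t * bump a b n t) \<le> \<bar>h t\<bar>" for n
      using bump_bounds[of a b n] by (intro AE_I2) (auto simp: abs_mult intro!: mult_left_le)
  qed
  moreover have "(LINT t|time_meas T. h t * bump a b n t) = 0" for n
    by (intro zero bump_test_function ab)
  ultimately show "(LINT t|time_meas T. indicator {a<..<b} t * h t) = 0"
    by (simp add: LIMSEQ_const_iff mult.commute)
qed

lemma integral_eq_integral_UNIV:
  fixes f :: "real \<Rightarrow> real"
  assumes "\<And>t. t \<notin> S \<Longrightarrow> f t = 0"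
  shows "integral S f = integral UNIV f"
proof -
  have "integral S f = integral UNIV (\<lambda>t. if t \<in> S then f t else 0)"
    by (simp add: integral_restrict_UNIV)
  also have "(\<lambda>t. if t \<in> S then f t else 0) = f" using assms by auto
  finally show ?thesis .
qed

lemma integrable_time_meas_continuous:
  fixes g :: "real \<Rightarrow> real"
  assumes "continuous_on UNIV g"
  shows "integrable (time_meas T) g"
proof -
  have "compact (g ` {0..T})"
    by (intro compact_continuous_image continuous_on_subset[OF assms]) auto
  then obtain B where "\<forall>x\<in>g ` {0..T}. norm x \<le> B"
    using compact_imp_bounded bounded_iff by metis
  then show ?thesis
    by (intro finite_measure.integrable_const_bound[where B=B] AE_I2
        borel_imp_time_measurable borel_measurable_continuous_onI assms) auto
qed

text \<open>An antiderivative vanishes to the left of the support, and the zero mean makes it vanish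
  to the right as well, so it has compact support.\<close>

lemma test_function_antiderivative:
  fixes \<psi> :: "real \<Rightarrow> real"
  assumes cont: "continuous_on UNIV \<psi>" and ab: "0 < a" "a < b" "b < T"
    and supp: "\<And>t. t \<notin> {a..b} \<Longrightarrow> \<psi> t = 0"
    and zero: "(LINT t|time_meas T. \<psi> t) = 0"
  obtains \<Theta> where "\<Theta> \<in> test_functions T" "deriv \<Theta> = \<psi>"
proof -
  \<comment> \<open>The lower limit -1 lies strictly to the left of the support, so that every
    \<open>t \<ge> a\<close> is interior to \<open>{-1..t+1}\<close>.\<close>
  define \<Theta> where "\<Theta> t = integral {-1..t} \<psi>" for t
  have early: "\<Theta> t = 0" if "t < a" for t
  proof -
    have "\<Theta> t = integral {-1..t} (\<lambda>_. 0)"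
      unfolding \<Theta>_def using that by (intro integral_cong supp) auto
    then show ?thesis by simp
  qed
  have late: "\<Theta> t = 0" if "t > b" for t
  proof -
    have "\<Theta> t = integral UNIV \<psi>"
      unfolding \<Theta>_def using that ab by (intro integral_eq_integral_UNIV supp) auto
    also have "\<dots> = integral {0<..<T} \<psi>"
      using ab by (intro integral_eq_integral_UNIV[symmetric] supp) auto
    also have "\<dots> = (LINT t|time_meas T. \<psi> t)"
      by (intro lebesgue_integral_eq_integral[symmetric] integrable_time_meas_continuous cont) simp
    finally show ?thesis using zero by simp
  qed
  have deriv: "(\<Theta> has_field_derivative \<psi> t) (at t)" for t
  proof (cases "t < a")
    case True
    have "((\<lambda>t::real. 0) has_field_derivative \<psi> t) (at t)"
      using True supp[of t] by (auto intro!: derivative_eq_intros)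
    then show ?thesis
      by (rule has_field_derivative_transform_within_open[of _ _ _ "{..<a}"]) (use True early in auto)
  next
    case False
    have "((\<lambda>t. integral {-1..t} \<psi>) has_real_derivative \<psi> t) (at t within {-1..t+1})"
      using False ab by (intro integral_has_real_derivative continuous_on_subset[OF cont]) auto
    moreover have "at t within {-1..t+1} = at t"
      using False ab by (intro at_within_interior) auto
    ultimately show ?thesis unfolding \<Theta>_def[abs_def] by metis
  qed
  show ?thesis
  proof
    show "deriv \<Theta> = \<psi>" using deriv by (auto intro: DERIV_imp_deriv)
    have "\<Theta> C1_differentiable_on UNIV"
      unfolding C1_differentiable_on_def using deriv cont
      by (auto simp: has_real_derivative_iff_has_vector_derivative)
    then show "\<Theta> \<in> test_functions T"
      unfolding test_functions_def
      using ab early late by (intro CollectI conjI exI[of _ "{a..b}"]) force+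
  qed
qed

text \<open>A multiple of a fixed bump \<open>\<theta>0\<close> is subtracted from an arbitrary test
  function to give it mean zero. The result is then the derivative of a test function, which reduces
  the claim to the fundamental lemma for \<open>h - c\<close>.\<close>

lemma du_Bois_Reymond:
  fixes h :: "real \<Rightarrow> real"
  assumes "T > 0" and h: "integrable (time_meas T) h"
    and zero: "\<And>\<theta>. \<theta> \<in> test_functions T \<Longrightarrow> (LINT t|time_meas T. h t * deriv \<theta> t) = 0"
  obtains c where "AE t in time_meas T. h t = c"
proof -
  let ?M = "time_meas T"
  define \<theta>0 where "\<theta>0 = bump (T/3) (2*T/3) 1"
  have T3: "0 < T/3" "T/3 < 2*T/3" "2*T/3 < T" using \<open>T > 0\<close> by auto
  have t0: "\<theta>0 \<in> test_functions T" unfolding \<theta>0_def by (rule bump_test_function[OF T3])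
  have hint: "integrable ?M (\<lambda>t. h t * \<theta> t)" if "\<theta> \<in> test_functions T" for \<theta>
    by (rule integrable_mult_continuous[OF h test_function_continuous(1)[OF that] test_function_bounded(1)[OF that]])
  have tint: "integrable ?M \<theta>" if "\<theta> \<in> test_functions T" for \<theta>
    by (rule integrable_time_meas_continuous[OF test_function_continuous(1)[OF that]])
  define I where "I = (LINT t|?M. \<theta>0 t)"
  \<comment> \<open>The bump is positive on its interval, so a zero integral would make an open
    interval negligible.\<close>
  have "I \<noteq> 0"
  proof
    assume "I = 0"
    then have "AE t in ?M. \<theta>0 t = 0"
      unfolding I_def using bump_bounds(1) tint[OF t0]
      by (subst (asm) integral_nonneg_eq_0_iff_AE) (auto simp: \<theta>0_def)
    then have "AE t in lebesgue. t \<in> {T/3<..<2*T/3} \<longrightarrow> False"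
      using bump_pos[of 1 _ "T/3" "2*T/3"] T3
      by (fastforce simp: AE_restrict_space_iff \<theta>0_def elim!: eventually_mono)
    then have "{T/3<..<2*T/3} \<in> null_sets lebesgue"
      by (subst AE_iff_null_sets) auto
    then have "negligible {T/3<..<2*T/3}" by (simp add: negligible_iff_null_sets)
    then show False using open_not_negligible[of "{T/3<..<2*T/3}"] T3 by auto
  qed
  \<comment> \<open>The mean of \<open>h\<close> weighted by \<open>\<theta>0\<close>; with this
    value, \<open>k\<close> times the integral of \<open>h * \<theta>0\<close> is \<open>c\<close>
    times the integral of \<open>\<theta>\<close>.\<close>
  define c where "c = (LINT t|?M. h t * \<theta>0 t) / I"
  have "AE t in ?M. h t - c = 0"
  proof (rule fundamental_lemma_calculus_of_variations)
    show "integrable ?M (\<lambda>t. h t - c)" using h by simp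
    fix \<theta> assume t: "\<theta> \<in> test_functions T"
    define k where "k = (LINT t|?M. \<theta> t) / I"
    define \<psi> where "\<psi> t = \<theta> t - k * \<theta>0 t" for t
    have psi_cont: "continuous_on UNIV \<psi>"
      unfolding \<psi>_def[abs_def] by (intro continuous_intros test_function_continuous(1)[OF t0] test_function_continuous(1)[OF t])
    have psi_zero: "(LINT t|?M. \<psi> t) = 0"
      unfolding \<psi>_def using tint[OF t] tint[OF t0] \<open>I \<noteq> 0\<close> by (simp add: I_def[symmetric] k_def)
    obtain a b where ab: "0 < a" "a < b" "b < T" "\<And>t. t \<notin> {a..b} \<Longrightarrow> \<psi> t = 0"
    proof (rule test_function_support[OF t])
      fix a b assume ab: "0 < a" "a < b" "b < T" "\<And>t. t \<notin> {a..b} \<Longrightarrow> \<theta> t = 0"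
      show thesis
      \<comment> \<open>The smallest interval that contains the supports of both
        \<open>\<theta>\<close> and \<open>\<theta>0\<close>.\<close>
      proof (rule that[of "min a (T/3)" "max b (2*T/3)"])
        fix t assume "t \<notin> {min a (T/3)..max b (2*T/3)}"
        then have "t \<notin> {a..b}" "t \<notin> {T/3<..<2*T/3}" by auto
        then show "\<psi> t = 0" using ab(4) bump_outside[OF T3(2)] by (simp add: \<psi>_def \<theta>0_def)
      qed (use ab T3 in auto)
    next
      assume "\<And>t. \<theta> t = 0"
      then show thesis
        by (intro that[of "T/3" "2*T/3"] T3)
          (auto simp: \<psi>_def \<theta>0_def intro!: bump_outside[OF T3(2)])
    qed
    obtain \<Theta> where \<Theta>: "\<Theta> \<in> test_functions T" "deriv \<Theta> = \<psi>"
      using test_function_antiderivative[OF psi_cont ab psi_zero] by blast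
    have "0 = (LINT t|?M. h t * \<theta> t - k * (h t * \<theta>0 t))"
      using zero[OF \<Theta>(1)] unfolding \<Theta>(2) \<psi>_def by (simp add: algebra_simps)
    also have "\<dots> = (LINT t|?M. h t * \<theta> t) - k * (LINT t|?M. h t * \<theta>0 t)"
      using hint[OF t] hint[OF t0] by simp
    also have "\<dots> = (LINT t|?M. h t * \<theta> t) - c * (LINT t|?M. \<theta> t)"
      by (simp add: k_def c_def)
    also have "\<dots> = (LINT t|?M. (h t - c) * \<theta> t)"
      using hint[OF t] tint[OF t] by (simp add: left_diff_distrib)
    finally show "(LINT t|?M. (h t - c) * \<theta> t) = 0" by simp
  qed
  then have "AE t in ?M. h t = c" by simp
  then show ?thesis by (rule that)
qed

section \<open>Primitives and continuous representatives\<close>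

text \<open>The variable limit is put into an indicator over a fixed measure, so that dominated
  convergence and Fubini apply directly.\<close>

definition primitive :: "real \<Rightarrow> (real \<Rightarrow> real) \<Rightarrow> real \<Rightarrow> real" where
  "primitive T g t = (LINT s|time_meas T. indicator {..<t} s * g s)"

lemma integrable_indicator_mult:
  fixes g :: "real \<Rightarrow> real"
  assumes "integrable (time_meas T) g" "A \<in> sets borel"
  shows "integrable (time_meas T) (\<lambda>s. indicator A s * g s)"
proof -
  have "integrable (time_meas T) (\<lambda>s. indicator (A \<inter> {0<..<T}) s *\<^sub>R g s)"
  proof (rule integrable_mult_indicator[OF _ assms(1)])
    show "A \<inter> {0<..<T} \<in> sets (time_meas T)"
      using assms(2) by (subst sets_restrict_space_iff) auto
  qed
  then show ?thesis
    by (rule Bochner_Integration.integrable_cong[THEN iffD1, rotated -1]) (auto simp: indicator_def)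
qed

text \<open>Dominated convergence along sequences: the indicators converge at every \<open>s\<close>
  except \<open>s = t\<close>, which is a null set.\<close>

lemma primitive_continuous:
  assumes g: "integrable (time_meas T) g"
  shows "continuous_on UNIV (primitive T g)"
  unfolding continuous_on_sequentially
proof (intro allI ballI impI, elim conjE)
  fix x :: "nat \<Rightarrow> real" and t assume x: "x \<longlonglongrightarrow> t"
  have null: "AE s in time_meas T. s \<noteq> t"
    using AE_completion[OF AE_lborel_singleton[of t]] by (auto simp: AE_restrict_space_iff elim!: eventually_mono)
  show "(primitive T g \<circ> x) \<longlonglongrightarrow> primitive T g t"
    unfolding primitive_def comp_def
  proof (rule integral_dominated_convergence[where w="\<lambda>s. \<bar>g s\<bar>"])
    show "AE s in time_meas T. (\<lambda>n. indicator {..<x n} s * g s) \<longlonglongrightarrow> indicator {..<t} s * g s"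
      using null
    proof eventually_elim
      fix s assume "s \<noteq> t"
      have "eventually (\<lambda>n. (indicator {..<x n} s :: real) = indicator {..<t} s) sequentially"
      proof (cases "s < t")
        case True
        from order_tendstoD(1)[OF x True] show ?thesis
          by eventually_elim (use True in auto)
      next
        case False
        then have "t < s" using \<open>s \<noteq> t\<close> by simp
        from order_tendstoD(2)[OF x this] show ?thesis
          by eventually_elim (use \<open>t < s\<close> in auto)
      qed
      then show "(\<lambda>n. indicator {..<x n} s * g s) \<longlonglongrightarrow> indicator {..<t} s * g s"
        by (intro tendsto_eventually) (auto elim!: eventually_mono)
    qed
    show "AE s in time_meas T. norm (indicator {..<x n} s * g s) \<le> \<bar>g s\<bar>" for n
      by (auto simp: indicator_def)
  qed (use integrable_indicator_mult[OF g] g in auto)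
qed

text \<open>Fubini on the triangle \<open>s < t\<close>: the inner integral of
  \<open>deriv \<theta>\<close> over \<open>(s, T)\<close> is \<open>- \<theta> s\<close>, because
  \<open>\<theta> T = 0\<close>.\<close>

lemma primitive_by_parts:
  assumes g: "integrable (time_meas T) g" and \<theta>: "\<theta> \<in> test_functions T"
  shows "(LINT t|time_meas T. primitive T g t * deriv \<theta> t) = - (LINT t|time_meas T. g t * \<theta> t)"
proof -
  let ?M = "time_meas T"
  interpret finite_measure ?M by simp
  interpret pair_sigma_finite ?M ?M ..
  obtain B where B: "\<And>t. t \<in> {0<..<T} \<Longrightarrow> \<bar>deriv \<theta> t\<bar> \<le> B"
    using test_function_bounded(2)[OF \<theta>] by metis
  have [measurable]: "g \<in> borel_measurable ?M" using g by simp
  have [measurable]: "deriv \<theta> \<in> borel_measurable borel"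
    by (intro borel_measurable_continuous_onI test_function_continuous(2)[OF \<theta>])
  have [measurable]: "(\<lambda>x. x) \<in> borel_measurable ?M"
    by (intro borel_imp_time_measurable) simp
  define F where "F s t = indicator {..<t} s * g s * deriv \<theta> t" for s t
  have F_meas: "case_prod F \<in> borel_measurable (?M \<Otimes>\<^sub>M ?M)"
  proof -
    have [measurable]: "fst \<in> borel_measurable (?M \<Otimes>\<^sub>M ?M)" "snd \<in> borel_measurable (?M \<Otimes>\<^sub>M ?M)"
      using measurable_compose[OF measurable_fst[of ?M ?M], of "\<lambda>x. x" borel]
        measurable_compose[OF measurable_snd[of ?M ?M], of "\<lambda>x. x" borel] by simp_all
    have "(\<lambda>p. if fst p < snd p then g (fst p) * deriv \<theta> (snd p) else 0) \<in> borel_measurable (?M \<Otimes>\<^sub>M ?M)"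
      by measurable
    also have "(\<lambda>p. if fst p < snd p then g (fst p) * deriv \<theta> (snd p) else 0) = case_prod F"
      by (auto simp: F_def fun_eq_iff)
    finally show ?thesis .
  qed
  \<comment> \<open>The bound on \<open>deriv \<theta>\<close> leaves a function of \<open>s\<close>
    alone, which is integrable on the square because the measure is finite.\<close>
  have dominating: "integrable (?M \<Otimes>\<^sub>M ?M) (\<lambda>p. B * g (fst p))"
  proof (rule Fubini_integrable)
    show "(\<lambda>p. B * g (fst p)) \<in> borel_measurable (?M \<Otimes>\<^sub>M ?M)" by measurable
  qed (use g in auto)
  have "integrable (?M \<Otimes>\<^sub>M ?M) (case_prod F)"
  proof (rule Bochner_Integration.integrable_bound[OF dominating F_meas AE_I2])
    fix p assume "p \<in> space (?M \<Otimes>\<^sub>M ?M)"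
    then have "snd p \<in> {0<..<T}" by (auto simp: space_pair_measure)
    then have "\<bar>g (fst p)\<bar> * \<bar>deriv \<theta> (snd p)\<bar> \<le> \<bar>g (fst p)\<bar> * \<bar>B\<bar>"
      using B[of "snd p"] by (intro mult_left_mono) auto
    then show "norm (case_prod F p) \<le> norm (B * g (fst p))"
      by (cases p) (auto simp: F_def abs_mult indicator_def mult.commute)
  qed
  then have "(LINT t|?M. LINT s|?M. F s t) = (LINT s|?M. LINT t|?M. F s t)"
    by (rule Fubini_integral)
  moreover have "(LINT s|?M. F s t) = primitive T g t * deriv \<theta> t" for t
    by (simp add: F_def primitive_def)
  moreover have "(LINT t|?M. F s t) = - (g s * \<theta> s)" if s: "s \<in> {0<..<T}" for s
  proof -
    have "(LINT t|?M. F s t) = g s * (LINT t|?M. indicator {s<..} t * deriv \<theta> t)"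
    proof -
      have "F s t = g s * (indicator {s<..} t * deriv \<theta> t)" for t
        by (simp add: F_def indicator_def)
      then show ?thesis by simp
    qed
    also have "(LINT t|?M. indicator {s<..} t * deriv \<theta> t) = integral {0<..<T} (\<lambda>t. indicator {s<..} t * deriv \<theta> t)"
      by (intro lebesgue_integral_eq_integral integrable_indicator_mult integrable_time_meas_continuous
          test_function_continuous(2)[OF \<theta>]) auto
    also have "\<dots> = integral UNIV (\<lambda>t. if t \<in> {0<..<T} then indicator {s<..} t * deriv \<theta> t else 0)"
      by (simp only: integral_restrict_UNIV)
    also have "(\<lambda>t. if t \<in> {0<..<T} then indicator {s<..} t * deriv \<theta> t else 0) = (\<lambda>t. if t \<in> {s<..<T} then deriv \<theta> t else 0)"
      using s by (auto simp: indicator_def)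
    also have "integral UNIV \<dots> = integral {s..T} (deriv \<theta>)"
      by (simp only: integral_restrict_UNIV integral_open_interval_real)
    also have "\<dots> = \<theta> T - \<theta> s"
      using s by (intro integral_unique fundamental_theorem_of_calculus)
        (auto simp: has_real_derivative_iff_has_vector_derivative[symmetric]
          intro: has_field_derivative_at_within test_function_continuous(3)[OF \<theta>])
    also have "\<theta> T = 0" using \<theta> by (auto simp: test_functions_def)
    finally show ?thesis by simp
  qed
  moreover have "(LINT s|?M. LINT t|?M. F s t) = (LINT s|?M. - (g s * \<theta> s))"
    by (intro Bochner_Integration.integral_cong calculation) auto
  ultimately show ?thesis by simp
qed

text \<open>Integration by parts shows that \<open>u - primitive T g\<close> has weak derivative
  zero, so it is constant by du Bois-Reymond.\<close>

lemma weak_deriv_continuous_representative: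
  assumes "T > 0" and u: "integrable (time_meas T) u" and g: "integrable (time_meas T) g"
    and wd: "has_weak_deriv T u g"
  obtains U where "continuous_on UNIV U" "AE t in time_meas T. U t = u t"
proof -
  have P: "integrable (time_meas T) (primitive T g)"
    by (intro integrable_time_meas_continuous primitive_continuous g)
  obtain c where c: "AE t in time_meas T. u t - primitive T g t = c"
  proof (rule du_Bois_Reymond[OF \<open>T > 0\<close>])
    show "integrable (time_meas T) (\<lambda>t. u t - primitive T g t)" using u P by simp
    fix \<theta> assume t: "\<theta> \<in> test_functions T"
    have i: "integrable (time_meas T) (\<lambda>t. v t * deriv \<theta> t)" if "integrable (time_meas T) v" for v
      by (rule integrable_mult_continuous[OF that test_function_continuous(2)[OF t] test_function_bounded(2)[OF t]])
    show "(LINT t|time_meas T. (u t - primitive T g t) * deriv \<theta> t) = 0"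
      using wd t i[OF u] i[OF P] primitive_by_parts[OF g t]
      by (simp add: left_diff_distrib has_weak_deriv_def)
  qed
  show ?thesis
  proof
    show "continuous_on UNIV (\<lambda>t. primitive T g t + c)"
      by (intro continuous_intros primitive_continuous g)
    show "AE t in time_meas T. primitive T g t + c = u t"
      using c by eventually_elim simp
  qed
qed

text \<open>The points of \<open>(0,T)\<close> where \<open>c\<close> and \<open>d\<close> differ
  form an open null set, hence none exist; continuity carries the equality to the endpoints, where
  traces are taken.\<close>

lemma continuous_AE_unique:
  fixes c d :: "real \<Rightarrow> 'a::real_normed_vector"
  assumes "T > 0" "continuous_on {0..T} c" "continuous_on {0..T} d" "AE t in time_meas T. c t = d t"
    and t: "t \<in> {0..T}"
  shows "c t = d t"
proof -
  have inner: "c s = d s" if s: "s \<in> {0<..<T}" for s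
  proof (rule ccontr)
    assume ne: "c s \<noteq> d s"
    have "continuous_on {0<..<T} (\<lambda>t. norm (c t - d t))"
      by (intro continuous_intros continuous_on_subset[OF assms(2)] continuous_on_subset[OF assms(3)]) auto
    then have op: "open ({0<..<T} \<inter> (\<lambda>t. norm (c t - d t)) -` {0<..})"
      by (intro continuous_open_preimage) auto
    have "AE t in lebesgue. t \<notin> {0<..<T} \<inter> (\<lambda>t. norm (c t - d t)) -` {0<..}"
      using assms(4) by (auto simp: AE_restrict_space_iff elim!: eventually_mono)
    then have "negligible ({0<..<T} \<inter> (\<lambda>t. norm (c t - d t)) -` {0<..})"
      using op by (simp add: negligible_iff_null_sets AE_iff_null_sets)
    then show False using open_not_negligible[OF op] s ne by force
  qed
  have cl: "closure {0<..<T} = {0..T}" using \<open>T > 0\<close> by simp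
  have "c t - d t = 0"
  proof (rule continuous_constant_on_closure[of "{0<..<T}" "\<lambda>t. c t - d t"])
    show "continuous_on (closure {0<..<T}) (\<lambda>t. c t - d t)"
      unfolding cl by (intro continuous_intros assms)
    show "c s - d s = 0" if "s \<in> {0<..<T}" for s using inner[OF that] by simp
    show "t \<in> closure {0<..<T}" unfolding cl by (rule t)
  qed
  then show ?thesis by simp
qed

section \<open>Square integrable functions\<close>

lemma measurable_norm:
  fixes u :: "'a \<Rightarrow> 'x::real_normed_vector"
  shows "u \<in> borel_measurable K \<Longrightarrow> (\<lambda>t. norm (u t)) \<in> borel_measurable K"
  using borel_measurable_continuous_on[OF continuous_on_norm_id] .

lemma L2_I:
  assumes "u \<in> borel_measurable (time_meas T)" "g \<in> L2 T"
    and "AE t in time_meas T. norm (u t) \<le> norm (g t)"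
  shows "u \<in> L2 T"
proof -
  have "integrable (time_meas T) (\<lambda>t. (norm (u t))\<^sup>2)"
  proof (rule Bochner_Integration.integrable_bound[where f="\<lambda>t. (norm (g t))\<^sup>2"])
    show "integrable (time_meas T) (\<lambda>t. (norm (g t))\<^sup>2)" using assms by (simp add: L2_def)
    show "(\<lambda>t. (norm (u t))\<^sup>2) \<in> borel_measurable (time_meas T)"
      using assms(1) by (intro borel_measurable_power measurable_norm)
    show "AE t in time_meas T. norm ((norm (u t))\<^sup>2) \<le> norm ((norm (g t))\<^sup>2)"
      using assms(3) by eventually_elim (auto intro: power_mono)
  qed
  with assms(1) show ?thesis by (simp add: L2_def)
qed

lemma L2_measurable: "u \<in> L2 T \<Longrightarrow> u \<in> borel_measurable (time_meas T)"
  by (simp add: L2_def)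

lemma L2_real_mult_integrable:
  fixes u v :: "real \<Rightarrow> real"
  assumes u: "u \<in> L2 T" and v: "v \<in> L2 T"
  shows "integrable (time_meas T) (\<lambda>t. u t * v t)"
proof (rule Bochner_Integration.integrable_bound[where f="\<lambda>t. (norm (u t))\<^sup>2 + (norm (v t))\<^sup>2"])
  show "integrable (time_meas T) (\<lambda>t. (norm (u t))\<^sup>2 + (norm (v t))\<^sup>2)"
    using u v by (simp add: L2_def)
  show "(\<lambda>t. u t * v t) \<in> borel_measurable (time_meas T)"
    by (intro borel_measurable_times L2_measurable u v)
  show "AE t in time_meas T. norm (u t * v t) \<le> norm ((norm (u t))\<^sup>2 + (norm (v t))\<^sup>2)"
  proof (rule AE_I2)
    fix t
    have "2 * (\<bar>u t\<bar> * \<bar>v t\<bar>) \<le> \<bar>u t\<bar>\<^sup>2 + \<bar>v t\<bar>\<^sup>2"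
      using sum_squares_bound[of "\<bar>u t\<bar>" "\<bar>v t\<bar>"] by simp
    moreover have "0 \<le> \<bar>u t\<bar> * \<bar>v t\<bar>" by simp
    ultimately have "\<bar>u t\<bar> * \<bar>v t\<bar> \<le> \<bar>u t\<bar>\<^sup>2 + \<bar>v t\<bar>\<^sup>2" by linarith
    then show "norm (u t * v t) \<le> norm ((norm (u t))\<^sup>2 + (norm (v t))\<^sup>2)"
      by (simp add: abs_mult)
  qed
qed

lemma L2_const: "(\<lambda>t. c :: real) \<in> L2 T"
  by (simp add: L2_def)

lemma L2_integrable:
  fixes u :: "real \<Rightarrow> real"
  assumes "u \<in> L2 T"
  shows "integrable (time_meas T) u"
  using L2_real_mult_integrable[OF assms L2_const[of 1]] by simp

lemma L2_norm_real: "u \<in> L2 T \<Longrightarrow> (\<lambda>t. norm (u t)) \<in> L2 T"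
  by (auto simp: L2_def intro: measurable_norm)

lemma L2_real_add:
  fixes u v :: "real \<Rightarrow> real"
  assumes u: "u \<in> L2 T" and v: "v \<in> L2 T"
  shows "(\<lambda>t. u t + v t) \<in> L2 T"
proof -
  have "integrable (time_meas T) (\<lambda>t. (u t)\<^sup>2 + 2 * (u t * v t) + (v t)\<^sup>2)"
    using u v L2_real_mult_integrable[OF u v] by (simp add: L2_def)
  moreover have "(\<lambda>t. (u t)\<^sup>2 + 2 * (u t * v t) + (v t)\<^sup>2) = (\<lambda>t. (u t + v t)\<^sup>2)"
    by (simp add: power2_sum algebra_simps)
  ultimately show ?thesis
    using L2_measurable[OF u] L2_measurable[OF v] by (simp add: L2_def)
qed

lemma L2_real_cmult:
  fixes u :: "real \<Rightarrow> real"
  assumes u: "u \<in> L2 T"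
  shows "(\<lambda>t. c * u t) \<in> L2 T"
  using u by (auto simp: L2_def power_mult_distrib)

lemma L2_real_sum:
  fixes u :: "nat \<Rightarrow> real \<Rightarrow> real"
  assumes "\<And>k. k < n \<Longrightarrow> u k \<in> L2 T"
  shows "(\<lambda>t. \<Sum>k<n. c k * u k t) \<in> L2 T"
  using assms
proof (induction n)
  case 0
  then show ?case using L2_const[of 0] by simp
next
  case (Suc n)
  then show ?case using L2_real_add[OF Suc.IH L2_real_cmult[of "u n" T "c n"]] by simp
qed

text \<open>The measurability is reduced to that of the coefficients, because sums of measurable functions
  with values in the dual space are only known to be measurable if that type is second countable.\<close>

lemma L2_coefficients:
  fixes F :: "nat \<Rightarrow> 'x::real_normed_vector"
  assumes s: "\<And>k. k < n \<Longrightarrow> s k \<in> L2 T"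
  shows "(\<lambda>t. \<Sum>k<n. s k t *\<^sub>R F k) \<in> L2 T"
proof (rule L2_I)
  \<comment> \<open>Coordinates from \<open>n\<close> on are set to 0, so that \<open>S\<close> is
    measurable into the product space of all real sequences, where the finite sum is a continuous
    map.\<close>
  define S where "S t k = (if k < n then s k t else 0)" for t k
  have "(\<lambda>t. S t k) \<in> borel_measurable (time_meas T)" for k
    using L2_measurable[OF s[of k]] by (cases "k < n") (simp_all add: S_def)
  then have "S \<in> borel_measurable (time_meas T)"
    by (rule measurable_coordinatewise_then_product)
  moreover have "continuous_on UNIV (\<lambda>x :: nat \<Rightarrow> real. \<Sum>k<n. x k *\<^sub>R F k)"
    by (intro continuous_intros continuous_on_product_coordinates)
  ultimately have "(\<lambda>t. \<Sum>k<n. S t k *\<^sub>R F k) \<in> borel_measurable (time_meas T)"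
    using borel_measurable_continuous_on by blast
  then show "(\<lambda>t. \<Sum>k<n. s k t *\<^sub>R F k) \<in> borel_measurable (time_meas T)"
    by (simp add: S_def)
  show "(\<lambda>t. \<Sum>k<n. norm (F k) * norm (s k t)) \<in> L2 T"
    by (intro L2_real_sum L2_norm_real s)
  show "AE t in time_meas T. norm (\<Sum>k<n. s k t *\<^sub>R F k) \<le> norm (\<Sum>k<n. norm (F k) * norm (s k t))"
  proof (rule AE_I2)
    fix t
    have "norm (\<Sum>k<n. s k t *\<^sub>R F k) \<le> (\<Sum>k<n. norm (F k) * norm (s k t))"
      by (rule sum_norm_le) (simp add: mult.commute)
    then show "norm (\<Sum>k<n. s k t *\<^sub>R F k) \<le> norm (\<Sum>k<n. norm (F k) * norm (s k t))"
      by simp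
  qed
qed

lemma L2_diff:
  fixes u v :: "real \<Rightarrow> 'x::{real_normed_vector, second_countable_topology}"
  assumes u: "u \<in> L2 T" and v: "v \<in> L2 T"
  shows "(\<lambda>t. u t - v t) \<in> L2 T"
proof (rule L2_I)
  show "(\<lambda>t. u t - v t) \<in> borel_measurable (time_meas T)"
    by (intro borel_measurable_diff L2_measurable u v)
  show "(\<lambda>t. norm (u t) + norm (v t)) \<in> L2 T"
    by (intro L2_real_add L2_norm_real u v)
qed (auto intro!: AE_I2 norm_triangle_ineq4)

lemma L2_form_integrable:
  fixes A :: "'x::{real_normed_vector, second_countable_topology} \<Rightarrow> 'x \<Rightarrow> real"
  assumes A: "bounded_bilinear A" and u: "u \<in> L2 T" and v: "v \<in> L2 T"
  shows "integrable (time_meas T) (\<lambda>t. A (u t) (v t))"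
proof -
  obtain K where K: "\<And>x y. norm (A x y) \<le> norm x * norm y * K"
    using bounded_bilinear.bounded[OF A] by blast
  show ?thesis
  proof (rule Bochner_Integration.integrable_bound[where f="\<lambda>t. norm (u t) * norm (v t) * K"])
    show "integrable (time_meas T) (\<lambda>t. norm (u t) * norm (v t) * K)"
      using L2_real_mult_integrable[OF L2_norm_real[OF u] L2_norm_real[OF v]] by simp
    show "(\<lambda>t. A (u t) (v t)) \<in> borel_measurable (time_meas T)"
      by (rule borel_measurable_continuous_Pair[OF L2_measurable[OF u] L2_measurable[OF v]
          bounded_bilinear.continuous_on[OF A continuous_on_fst[OF continuous_on_id] continuous_on_snd[OF continuous_on_id]]])
    show "AE t in time_meas T. norm (A (u t) (v t)) \<le> norm (norm (u t) * norm (v t) * K)"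
      using K order_trans[OF K abs_ge_self] by (intro AE_I2) auto
  qed
qed

lemma L2_apply:
  assumes g: "g \<in> L2 T"
  shows "(\<lambda>t. blinfun_apply (g t) v) \<in> L2 T"
proof (rule L2_I)
  have "continuous_on UNIV (\<lambda>h. blinfun_apply h v)" by (intro continuous_intros)
  then show "(\<lambda>t. blinfun_apply (g t) v) \<in> borel_measurable (time_meas T)"
    using L2_measurable[OF g] borel_measurable_continuous_on by blast
  show "(\<lambda>t. norm v * norm (g t)) \<in> L2 T" by (intro L2_real_cmult L2_norm_real g)
  show "AE t in time_meas T. norm (g t v) \<le> norm (norm v * norm (g t))"
    using norm_blinfun by (intro AE_I2) (fastforce simp: mult.commute)
qed

text \<open>Weak measurability of \<open>g\<close> suffices: \<open>q\<close> is a pointwise limit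
  of simple functions, on whose finitely many values the pairing is measurable, and each
  \<open>g t\<close> is continuous.\<close>

lemma pairing_measurable:
  fixes q :: "'a \<Rightarrow> 'x::{real_normed_vector, second_countable_topology}"
  assumes g: "\<And>v. (\<lambda>t. blinfun_apply (g t) v :: real) \<in> borel_measurable K"
    and q: "q \<in> borel_measurable K"
  shows "(\<lambda>t. g t (q t)) \<in> borel_measurable K"
proof -
  obtain s where s: "\<And>i. simple_function K (s i)" "\<And>t. t \<in> space K \<Longrightarrow> (\<lambda>i. s i t) \<longlonglongrightarrow> q t"
    using borel_measurable_implies_sequence_metric[OF q, of undefined] by metis
  show ?thesis
  proof (rule borel_measurable_LIMSEQ_real)
    show "(\<lambda>i. g t (s i t)) \<longlonglongrightarrow> g t (q t)" if "t \<in> space K" for t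
      by (intro tendsto_intros s that)
    show "(\<lambda>t. g t (s i t)) \<in> borel_measurable K" for i
    proof (rule measurable_compose_countable'[where I="s i ` space K"])
      show "countable (s i ` space K)" using s(1)[of i] by (simp add: simple_function_def countable_finite)
      show "s i \<in> measurable K (count_space (s i ` space K))"
        using s(1)[of i] by (auto simp: measurable_count_space_eq2 simple_function_def)
    qed (rule g)
  qed
qed

lemma L2_pairing_integrable:
  fixes q :: "real \<Rightarrow> 'x::{real_normed_vector, second_countable_topology}"
  assumes g: "g \<in> L2 T" and q: "q \<in> L2 T"
  shows "integrable (time_meas T) (\<lambda>t. blinfun_apply (g t) (q t) :: real)"
proof (rule Bochner_Integration.integrable_bound[where f="\<lambda>t. norm (g t) * norm (q t)"])
  show "integrable (time_meas T) (\<lambda>t. norm (g t) * norm (q t))"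
    by (intro L2_real_mult_integrable L2_norm_real g q)
  show "(\<lambda>t. blinfun_apply (g t) (q t)) \<in> borel_measurable (time_meas T)"
    by (rule pairing_measurable[OF L2_measurable[OF L2_apply[OF g]] L2_measurable[OF q]])
  show "AE t in time_meas T. norm (g t (q t)) \<le> norm (norm (g t) * norm (q t))"
    by (intro AE_I2) (metis norm_blinfun abs_ge_self order_trans real_norm_def)
qed

section \<open>Spans of finite families\<close>

lemma L2_span_L2: "u \<in> L2_span T n b \<Longrightarrow> u \<in> L2 T"
  by (simp add: L2_span_def)

lemma L2_span_diff:
  fixes b :: "nat \<Rightarrow> real \<Rightarrow> 'x::{real_normed_vector, second_countable_topology}"
  assumes "u \<in> L2_span T n b" "v \<in> L2_span T n b"
  shows "(\<lambda>t. u t - v t) \<in> L2_span T n b"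
proof -
  obtain c d where cd: "AE t in time_meas T. u t = (\<Sum>k<n. c k *\<^sub>R b k t)"
    "AE t in time_meas T. v t = (\<Sum>k<n. d k *\<^sub>R b k t)"
    using assms by (auto simp: L2_span_def)
  from cd have "AE t in time_meas T. u t - v t = (\<Sum>k<n. (c k - d k) *\<^sub>R b k t)"
    by eventually_elim (simp add: scaleR_diff_left sum_subtractf)
  then have "\<exists>e. AE t in time_meas T. u t - v t = (\<Sum>k<n. e k *\<^sub>R b k t)"
    by (intro exI[of _ "\<lambda>k. c k - d k"])
  then show ?thesis
    using L2_diff[of u T v] assms by (simp add: L2_span_def)
qed

text \<open>Each \<open>x l\<close> is a combination outside a null set of its own; there are
  finitely many of these sets, so substitution is valid almost everywhere.\<close>

lemma L2_span_subset:
  assumes "\<And>l. l < m \<Longrightarrow> x l \<in> L2_span T n b"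
  shows "L2_span T m x \<subseteq> L2_span T n b"
proof
  fix u assume u: "u \<in> L2_span T m x"
  then obtain c where c: "AE t in time_meas T. u t = (\<Sum>l<m. c l *\<^sub>R x l t)"
    by (auto simp: L2_span_def)
  have ex: "\<exists>d. AE t in time_meas T. x l t = (\<Sum>k<n. d k *\<^sub>R b k t)" if "l < m" for l
    using assms[OF that] by (auto simp: L2_span_def)
  define d where "d l = (SOME d. AE t in time_meas T. x l t = (\<Sum>k<n. d k *\<^sub>R b k t))" for l
  have "AE t in time_meas T. x l t = (\<Sum>k<n. d l k *\<^sub>R b k t)" if "l < m" for l
    unfolding d_def by (rule someI_ex[OF ex[OF that]])
  then have "AE t in time_meas T. \<forall>l\<in>{..<m}. x l t = (\<Sum>k<n. d l k *\<^sub>R b k t)"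
    by (intro AE_finite_allI) auto
  with c have "AE t in time_meas T. u t = (\<Sum>k<n. (\<Sum>l<m. c l * d l k) *\<^sub>R b k t)"
  proof eventually_elim
    case (elim t)
    then have "u t = (\<Sum>l<m. \<Sum>k<n. (c l * d l k) *\<^sub>R b k t)"
      by (simp add: scaleR_sum_right)
    also have "\<dots> = (\<Sum>k<n. (\<Sum>l<m. c l * d l k) *\<^sub>R b k t)"
      by (subst sum.swap) (simp add: scaleR_sum_left)
    finally show ?case .
  qed
  then have "\<exists>e. AE t in time_meas T. u t = (\<Sum>k<n. e k *\<^sub>R b k t)"
    by (rule exI[where x="\<lambda>k. \<Sum>l<m. c l * d l k"])
  then show "u \<in> L2_span T n b"
    using L2_span_L2[OF u] by (simp add: L2_span_def)
qed

section \<open>Calculus of weak derivatives\<close>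

lemma has_weak_deriv_sum:
  assumes "\<And>k. k < n \<Longrightarrow> integrable (time_meas T) (u k)" "\<And>k. k < n \<Longrightarrow> integrable (time_meas T) (g k)"
    and "\<And>k. k < n \<Longrightarrow> has_weak_deriv T (u k) (g k)"
  shows "has_weak_deriv T (\<lambda>t. \<Sum>k<n. c k * u k t) (\<lambda>t. \<Sum>k<n. c k * g k t)"
  unfolding has_weak_deriv_def
proof
  fix \<theta> assume t: "\<theta> \<in> test_functions T"
  have i: "integrable (time_meas T) (\<lambda>t. v t * deriv \<theta> t)"
    "integrable (time_meas T) (\<lambda>t. v t * \<theta> t)" if "integrable (time_meas T) v" for v
    using that test_function_continuous[OF t] test_function_bounded[OF t]
    by (auto intro!: integrable_mult_continuous)
  have "(LINT t|time_meas T. (\<Sum>k<n. c k * u k t) * deriv \<theta> t)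
      = (\<Sum>k<n. c k * (LINT t|time_meas T. u k t * deriv \<theta> t))"
    using i(1)[OF assms(1)]
    by (simp add: sum_distrib_right mult.assoc Bochner_Integration.integral_sum)
  also have "\<dots> = (\<Sum>k<n. c k * - (LINT t|time_meas T. g k t * \<theta> t))"
    using assms(3) t by (auto simp: has_weak_deriv_def)
  also have "\<dots> = - (LINT t|time_meas T. (\<Sum>k<n. c k * g k t) * \<theta> t)"
    using i(2)[OF assms(2)]
    by (simp add: sum_distrib_right mult.assoc Bochner_Integration.integral_sum sum_negf)
  finally show "(LINT t|time_meas T. (\<Sum>k<n. c k * u k t) * deriv \<theta> t)
      = - (LINT t|time_meas T. (\<Sum>k<n. c k * g k t) * \<theta> t)" .
qed

lemma has_weak_deriv_diff:
  assumes "integrable (time_meas T) u" "integrable (time_meas T) v"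
    "integrable (time_meas T) g" "integrable (time_meas T) h"
    and "has_weak_deriv T u g" "has_weak_deriv T v h"
  shows "has_weak_deriv T (\<lambda>t. u t - v t) (\<lambda>t. g t - h t)"
proof -
  have "has_weak_deriv T (\<lambda>t. \<Sum>k<(2::nat). (if k = 0 then 1 else -1) * (if k = 0 then u else v) t)
     (\<lambda>t. \<Sum>k<(2::nat). (if k = 0 then 1 else -1) * (if k = 0 then g else h) t)"
    using assms by (intro has_weak_deriv_sum) auto
  then show ?thesis by (simp add: numeral_2_eq_2)
qed

text \<open>Members of the discrete spaces agree with their basis expansion only almost everywhere,
  so weak derivatives must pass between representatives.\<close>

lemma has_weak_deriv_cong_AE:
  assumes "has_weak_deriv T u g" "integrable (time_meas T) u" "integrable (time_meas T) v"
    and "AE t in time_meas T. u t = v t"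
  shows "has_weak_deriv T v g"
  unfolding has_weak_deriv_def
proof
  fix \<theta> assume t: "\<theta> \<in> test_functions T"
  have i: "integrable (time_meas T) (\<lambda>t. v t * deriv \<theta> t)" if "integrable (time_meas T) v" for v
    using that test_function_continuous[OF t] test_function_bounded[OF t]
    by (auto intro!: integrable_mult_continuous)
  have "(LINT t|time_meas T. v t * deriv \<theta> t) = (LINT t|time_meas T. u t * deriv \<theta> t)"
    using assms(4)
    by (intro integral_cong_AE borel_measurable_integrable i assms) (auto elim!: eventually_mono)
  then show "(LINT t|time_meas T. v t * deriv \<theta> t) = - (LINT t|time_meas T. g t * \<theta> t)"
    using assms(1) t by (simp add: has_weak_deriv_def)
qed

lemma has_weak_deriv_unique:
  assumes "has_weak_deriv T u g" "has_weak_deriv T u h"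
    and "integrable (time_meas T) g" "integrable (time_meas T) h"
  shows "AE t in time_meas T. g t = h t"
proof -
  have "AE t in time_meas T. g t - h t = 0"
  proof (rule fundamental_lemma_calculus_of_variations)
    show "integrable (time_meas T) (\<lambda>t. g t - h t)" using assms by simp
    fix \<theta> assume t: "\<theta> \<in> test_functions T"
    have i: "integrable (time_meas T) (\<lambda>t. v t * \<theta> t)" if "integrable (time_meas T) v" for v
      using that test_function_continuous[OF t] test_function_bounded[OF t]
      by (auto intro!: integrable_mult_continuous)
    show "(LINT t|time_meas T. (g t - h t) * \<theta> t) = 0"
      using assms(1,2) t i[OF assms(3)] i[OF assms(4)]
      by (simp add: has_weak_deriv_def left_diff_distrib)
  qed
  then show ?thesis by simp
qed

lemma weak_deriv_props:
  assumes "u \<in> H1 T"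
  shows "u \<in> L2 T" "weak_deriv T u \<in> L2 T" "has_weak_deriv T u (weak_deriv T u)"
proof -
  show "u \<in> L2 T" using assms by (simp add: H1_def)
  have "\<exists>g. g \<in> L2 T \<and> has_weak_deriv T u g" using assms by (auto simp: H1_def)
  from someI_ex[OF this] show "weak_deriv T u \<in> L2 T" "has_weak_deriv T u (weak_deriv T u)"
    by (auto simp: weak_deriv_def)
qed

section \<open>Tensor product spaces, time derivatives and traces\<close>

text \<open>The class \<open>second_countable_topology\<close> encodes separability and keeps Borel
  measurability stable under differences and pairing of functions with values in these
  spaces.\<close>

locale space_time =
  fixes \<iota> :: "'v::{real_inner,complete_space,second_countable_topology} \<Rightarrow>\<^sub>L
              'h::{real_inner,complete_space,second_countable_topology}"
    and T :: real and P M N :: nat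
    and \<psi> chi :: "nat \<Rightarrow> real \<Rightarrow> real" and \<phi> :: "nat \<Rightarrow> 'v"
  assumes T_pos: "T > 0"
    and psi_L2: "\<And>p. p < P \<Longrightarrow> \<psi> p \<in> L2 T"
    and chi_H1: "\<And>m. m < M \<Longrightarrow> chi m \<in> H1 T"
begin

abbreviation "Wd \<equiv> tensor_space T M N chi \<phi>"
abbreviation "Qd \<equiv> tensor_space T P N \<psi> \<phi>"
abbreviation "tderiv \<equiv> time_deriv T \<iota>"
abbreviation "tr \<equiv> trace_at T \<iota>"

lemma div_less: "k < m * N \<Longrightarrow> k div N < m"
  by (simp add: less_mult_imp_div_less)

lemma Wd_L2: "w \<in> Wd \<Longrightarrow> w \<in> L2 T"
  by (simp add: tensor_space_def L2_span_def)

lemma Qd_L2: "q \<in> Qd \<Longrightarrow> q \<in> L2 T"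
  by (simp add: tensor_space_def L2_span_def)

lemma Wd_diff: "v \<in> Wd \<Longrightarrow> w \<in> Wd \<Longrightarrow> (\<lambda>t. v t - w t) \<in> Wd"
  unfolding tensor_space_def by (rule L2_span_diff)

lemma Qd_combination: "(\<lambda>t. \<Sum>k<P*N. c k *\<^sub>R tensor_basis N \<psi> \<phi> k t) \<in> Qd"
proof -
  have "(\<lambda>t. \<Sum>k<P*N. (c k * \<psi> (k div N) t) *\<^sub>R \<phi> (k mod N)) \<in> L2 T"
    by (intro L2_coefficients L2_real_cmult psi_L2 div_less)
  then show ?thesis by (auto simp: tensor_space_def L2_span_def tensor_basis_def)
qed

text \<open>Lets inequalities on the span of the \<open>\<phi>\<close> be integrated in time;
  \<open>N > 0\<close> ensures \<open>k mod N < N\<close>.\<close>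

lemma tensor_space_in_span:
  assumes "N > 0" "w \<in> tensor_space T m N b \<phi>"
  shows "AE t in time_meas T. w t \<in> span (\<phi> ` {..<N})"
proof -
  obtain c where "AE t in time_meas T. w t = (\<Sum>k<m*N. c k *\<^sub>R b (k div N) t *\<^sub>R \<phi> (k mod N))"
    using assms by (auto simp: tensor_space_def L2_span_def tensor_basis_def)
  then show ?thesis
  proof eventually_elim
    case (elim t)
    show ?case unfolding elim
      using assms(1) by (intro span_sum span_scale span_base) auto
  qed
qed

lemma integrable_inner_Wd:
  assumes "w \<in> Wd"
  shows "integrable (time_meas T) (\<lambda>t. inner (\<iota> (w t)) (\<iota> v))"
proof (rule L2_integrable[OF L2_I])
  have "continuous_on UNIV (\<lambda>x. inner (\<iota> x) (\<iota> v))"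
    by (intro continuous_intros)
  then show "(\<lambda>t. inner (\<iota> (w t)) (\<iota> v)) \<in> borel_measurable (time_meas T)"
    using L2_measurable[OF Wd_L2[OF assms]] borel_measurable_continuous_on by blast
  show "(\<lambda>t. (norm \<iota> * norm (\<iota> v)) * norm (w t)) \<in> L2 T"
    by (intro L2_real_cmult L2_norm_real Wd_L2 assms)
  show "AE t in time_meas T. norm (inner (\<iota> (w t)) (\<iota> v)) \<le> norm ((norm \<iota> * norm (\<iota> v)) * norm (w t))"
  proof (rule AE_I2)
    fix t
    have "\<bar>inner (\<iota> (w t)) (\<iota> v)\<bar> \<le> norm (\<iota> (w t)) * norm (\<iota> v)"
      by (rule Cauchy_Schwarz_ineq2)
    also have "\<dots> \<le> (norm \<iota> * norm (w t)) * norm (\<iota> v)"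
      by (intro mult_right_mono norm_blinfun) simp
    finally show "norm (inner (\<iota> (w t)) (\<iota> v)) \<le> norm ((norm \<iota> * norm (\<iota> v)) * norm (w t))"
      by (simp add: mult_ac)
  qed
qed

lemma Wd_time_deriv_exists:
  assumes "w \<in> Wd"
  shows "\<exists>g. g \<in> L2 T \<and> has_time_deriv T \<iota> w g"
proof -
  obtain c where c: "AE t in time_meas T. w t = (\<Sum>k<M*N. c k *\<^sub>R chi (k div N) t *\<^sub>R \<phi> (k mod N))"
    using assms by (auto simp: tensor_space_def L2_span_def tensor_basis_def)
  \<comment> \<open>\<open>F k\<close> is the basis vector regarded as a functional on the first
    space through the inner product of the second; \<open>g\<close> differentiates only the time
    factors.\<close>
  define F where "F k = blinfun_inner_right (\<iota> (\<phi> (k mod N))) o\<^sub>L \<iota>" for k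
  define g where "g t = (\<Sum>k<M*N. (c k * weak_deriv T (chi (k div N)) t) *\<^sub>R F k)" for t
  have chi: "chi (k div N) \<in> H1 T" if "k < M * N" for k
    using that by (intro chi_H1 div_less)
  note chi_props = weak_deriv_props[OF chi]
  have "g \<in> L2 T"
    unfolding g_def[abs_def] by (intro L2_coefficients L2_real_cmult chi_props)
  moreover have "has_time_deriv T \<iota> w g"
    unfolding has_time_deriv_def
  proof
    fix v
    let ?d = "\<lambda>k. c k * inner (\<iota> (\<phi> (k mod N))) (\<iota> v)"
    have "has_weak_deriv T (\<lambda>t. \<Sum>k<M*N. ?d k * chi (k div N) t)
        (\<lambda>t. \<Sum>k<M*N. ?d k * weak_deriv T (chi (k div N)) t)"
      by (intro has_weak_deriv_sum L2_integrable chi_props)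
    also have "(\<lambda>t. \<Sum>k<M*N. ?d k * weak_deriv T (chi (k div N)) t) = (\<lambda>t. g t v)"
      by (simp add: g_def F_def blinfun.sum_left blinfun.scaleR_left mult_ac)
    finally have *: "has_weak_deriv T (\<lambda>t. \<Sum>k<M*N. ?d k * chi (k div N) t) (\<lambda>t. g t v)" .
    show "has_weak_deriv T (\<lambda>t. inner (\<iota> (w t)) (\<iota> v)) (\<lambda>t. g t v)"
    proof (rule has_weak_deriv_cong_AE[OF *])
      show "integrable (time_meas T) (\<lambda>t. \<Sum>k<M*N. ?d k * chi (k div N) t)"
        by (intro L2_integrable L2_real_sum chi_props)
      show "AE t in time_meas T. (\<Sum>k<M*N. ?d k * chi (k div N) t) = inner (\<iota> (w t)) (\<iota> v)"
        using c by eventually_elim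
          (simp add: blinfun.sum_right blinfun.scaleR_right inner_sum_left mult_ac)
      show "integrable (time_meas T) (\<lambda>t. inner (\<iota> (w t)) (\<iota> v))"
        by (rule integrable_inner_Wd[OF assms])
    qed
  qed
  ultimately show ?thesis by blast
qed

lemma Wd_time_deriv:
  assumes "w \<in> Wd"
  shows "tderiv w \<in> L2 T" "has_time_deriv T \<iota> w (tderiv w)"
  using someI_ex[OF Wd_time_deriv_exists[OF assms]] by (auto simp: time_deriv_def)

lemma time_deriv_diff:
  assumes v: "v \<in> Wd" and w: "w \<in> Wd"
  shows "AE t in time_meas T. tderiv (\<lambda>t. v t - w t) t x = tderiv v t x - tderiv w t x"
proof (rule has_weak_deriv_unique)
  note d = Wd_time_deriv[OF Wd_diff[OF v w]] Wd_time_deriv[OF v] Wd_time_deriv[OF w]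
  show "has_weak_deriv T (\<lambda>t. inner (\<iota> (v t - w t)) (\<iota> x)) (\<lambda>t. tderiv (\<lambda>t. v t - w t) t x)"
    using d(2) by (simp add: has_time_deriv_def)
  show "has_weak_deriv T (\<lambda>t. inner (\<iota> (v t - w t)) (\<iota> x)) (\<lambda>t. tderiv v t x - tderiv w t x)"
    using has_weak_deriv_diff[OF integrable_inner_Wd[OF v] integrable_inner_Wd[OF w]
        L2_integrable[OF L2_apply[OF d(3)]] L2_integrable[OF L2_apply[OF d(5)]], of x x x x] d(4,6)
    by (simp add: has_time_deriv_def blinfun.diff_right inner_diff_left)
  show "integrable (time_meas T) (\<lambda>t. tderiv (\<lambda>t. v t - w t) t x)"
    by (intro L2_integrable L2_apply d)
  show "integrable (time_meas T) (\<lambda>t. tderiv v t x - tderiv w t x)"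
    by (intro Bochner_Integration.integrable_diff L2_integrable L2_apply d)
qed

text \<open>In \<open>time_deriv_diff\<close> the exceptional null set depends on \<open>x\<close>.
  Since \<open>q\<close> takes values in the span of finitely many \<open>\<phi>\<close>, a single
  null set serves here.\<close>

lemma time_deriv_diff_pairing:
  assumes v: "v \<in> Wd" and w: "w \<in> Wd" and q: "q \<in> Qd"
  shows "(LINT t|time_meas T. tderiv (\<lambda>t. v t - w t) t (q t))
    = (LINT t|time_meas T. tderiv v t (q t)) - (LINT t|time_meas T. tderiv w t (q t))"
proof -
  note d = Wd_time_deriv(1)[OF Wd_diff[OF v w]] Wd_time_deriv(1)[OF v] Wd_time_deriv(1)[OF w]
  note i = L2_pairing_integrable[OF d(1) Qd_L2[OF q]] L2_pairing_integrable[OF d(2) Qd_L2[OF q]]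
    L2_pairing_integrable[OF d(3) Qd_L2[OF q]]
  obtain c where c: "AE t in time_meas T. q t = (\<Sum>k<P*N. c k *\<^sub>R tensor_basis N \<psi> \<phi> k t)"
    using q by (auto simp: tensor_space_def L2_span_def)
  have "AE t in time_meas T. \<forall>k\<in>{..<P*N}. tderiv (\<lambda>t. v t - w t) t (\<phi> (k mod N))
      = tderiv v t (\<phi> (k mod N)) - tderiv w t (\<phi> (k mod N))"
    by (intro AE_finite_allI time_deriv_diff v w) simp
  with c have "AE t in time_meas T. tderiv (\<lambda>t. v t - w t) t (q t) = tderiv v t (q t) - tderiv w t (q t)"
    by eventually_elim
      (simp add: tensor_basis_def blinfun.sum_right blinfun.scaleR_right sum_subtractf[symmetric] right_diff_distrib)
  then have "(LINT t|time_meas T. tderiv (\<lambda>t. v t - w t) t (q t))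
      = (LINT t|time_meas T. tderiv v t (q t) - tderiv w t (q t))"
    by (intro integral_cong_AE borel_measurable_integrable i Bochner_Integration.integrable_diff)
  then show ?thesis using i by simp
qed

text \<open>Replacing each \<open>chi m\<close> in the expansion by its continuous representative
  gives a continuous candidate, so the choice in \<open>trace_at\<close> is meaningful.\<close>

lemma Wd_trace:
  assumes w: "w \<in> Wd"
  shows "continuous_on {0..T} (tr w)" "AE t in time_meas T. tr w t = \<iota> (w t)"
proof -
  obtain c where c: "AE t in time_meas T. w t = (\<Sum>k<M*N. c k *\<^sub>R chi (k div N) t *\<^sub>R \<phi> (k mod N))"
    using w by (auto simp: tensor_space_def L2_span_def tensor_basis_def)
  have "\<exists>U. continuous_on UNIV U \<and> (AE t in time_meas T. U t = chi m t)" if "m < M" for m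
    using weak_deriv_continuous_representative[OF T_pos _ _ weak_deriv_props(3)[OF chi_H1[OF that]]]
      weak_deriv_props(1,2)[OF chi_H1[OF that]] L2_integrable by metis
  then obtain U where U: "\<And>m. m < M \<Longrightarrow> continuous_on UNIV (U m)"
    "\<And>m. m < M \<Longrightarrow> AE t in time_meas T. U m t = chi m t" by metis
  define C where "C t = (\<Sum>k<M*N. c k *\<^sub>R U (k div N) t *\<^sub>R \<iota> (\<phi> (k mod N)))" for t
  have "continuous_on {0..T} C"
    unfolding C_def[abs_def] using U(1) div_less
    by (intro continuous_intros) (auto intro: continuous_on_subset)
  moreover have "AE t in time_meas T. \<forall>m\<in>{..<M}. U m t = chi m t"
    using U(2) by (intro AE_finite_allI) auto
  with c have "AE t in time_meas T. C t = \<iota> (w t)"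
  proof eventually_elim
    case (elim t)
    then show ?case
      unfolding C_def using div_less
      by (auto simp: blinfun.sum_right blinfun.scaleR_right intro!: sum.cong)
  qed
  ultimately have "\<exists>c. continuous_on {0..T} c \<and> (AE t in time_meas T. c t = \<iota> (w t))" by blast
  from someI_ex[OF this] show "continuous_on {0..T} (tr w)" "AE t in time_meas T. tr w t = \<iota> (w t)"
    by (auto simp: trace_at_def)
qed

lemma trace_diff:
  assumes v: "v \<in> Wd" and w: "w \<in> Wd" and "t \<in> {0..T}"
  shows "tr (\<lambda>t. v t - w t) t = tr v t - tr w t"
proof (rule continuous_AE_unique[OF T_pos _ _ _ assms(3)])
  show "continuous_on {0..T} (tr (\<lambda>t. v t - w t))" "continuous_on {0..T} (\<lambda>t. tr v t - tr w t)"
    by (intro Wd_trace Wd_diff continuous_intros v w)+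
  show "AE t in time_meas T. tr (\<lambda>t. v t - w t) t = tr v t - tr w t"
    using Wd_trace(2)[OF Wd_diff[OF v w]] Wd_trace(2)[OF v] Wd_trace(2)[OF w]
    by eventually_elim (simp add: blinfun.diff_right)
qed

end

section \<open>The Riesz lift and the discrete form\<close>

text \<open>A solvability criterion that admits singular \<open>G\<close>: the right-hand side has
  to annihilate every vector of zero energy. The system is enlarged by one row and column at a
  time.\<close>

lemma gram_solvable:
  fixes G :: "nat \<Rightarrow> nat \<Rightarrow> real"
  assumes sym: "\<And>i j. G i j = G j i"
    and null: "\<And>m c j. m \<le> n \<Longrightarrow> j < n \<Longrightarrow> (\<Sum>i<m. \<Sum>j<m. c i * c j * G i j) = 0 \<Longrightarrow> (\<Sum>i<m. c i * G i j) = 0"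
  shows "m \<le> n \<Longrightarrow> (\<And>c. (\<Sum>i<m. \<Sum>j<m. c i * c j * G i j) = 0 \<Longrightarrow> (\<Sum>i<m. c i * l i) = 0) \<Longrightarrow>
    \<exists>c. \<forall>i<m. (\<Sum>j<m. G i j * c j) = l i"
proof (induction m arbitrary: l)
  case 0
  show ?case by simp
next
  case (Suc m)
  have "\<exists>r. \<forall>i<m. (\<Sum>j<m. G i j * r j) = l i"
  proof (rule Suc.IH)
    show "m \<le> n" using Suc.prems by simp
    fix c assume "(\<Sum>i<m. \<Sum>j<m. c i * c j * G i j) = 0"
    \<comment> \<open>Padding with a zero turns \<open>c\<close> into a vector of the larger system
      with the same energy.\<close>
    then show "(\<Sum>i<m. c i * l i) = 0"
      using Suc.prems(2)[of "c(m := 0)"] by simp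
  qed
  then obtain r where r: "\<And>i. i < m \<Longrightarrow> (\<Sum>j<m. G i j * r j) = l i" by blast
  \<comment> \<open>The new column is an admissible right-hand side for the smaller system; this is
    why \<open>null\<close> also covers columns beyond the leading block.\<close>
  have "\<exists>s. \<forall>i<m. (\<Sum>j<m. G i j * s j) = G i m"
    using Suc.prems null[of m m] by (intro Suc.IH) auto
  then obtain s where s: "\<And>i. i < m \<Longrightarrow> (\<Sum>j<m. G i j * s j) = G i m" by blast
  txt \<open>Gram--Schmidt step: \<open>d\<close> is the last unit vector made orthogonal to the first \<open>m\<close> ones.\<close>
  define d where "d i = (if i < m then - s i else 1)" for i
  have d_lt: "(\<Sum>j<m. x j * d j) = - (\<Sum>j<m. x j * s j)" for x
    by (simp add: d_def sum_negf)
  have orth: "(\<Sum>j<Suc m. G i j * d j) = 0" if "i < m" for i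
    using s[OF that] d_lt[of "G i"] by (simp add: d_def)
  define D where "D = (\<Sum>j<Suc m. G m j * d j)"
  show ?case
  proof (cases "D = 0")
    \<comment> \<open>Now \<open>d\<close> has zero energy, so \<open>l\<close> annihilates it. This
      is exactly what makes \<open>r\<close>, extended by 0, satisfy the last equation too.\<close>
    case True
    have "(\<Sum>i<Suc m. \<Sum>j<Suc m. d i * d j * G i j) = (\<Sum>i<Suc m. d i * (\<Sum>j<Suc m. G i j * d j))"
      by (simp only: sum_distrib_left mult_ac)
    also have "\<dots> = d m * D + (\<Sum>i<m. d i * (\<Sum>j<Suc m. G i j * d j))"
      by (simp add: D_def)
    also have "(\<Sum>i<m. d i * (\<Sum>j<Suc m. G i j * d j)) = 0"
      using orth by (intro sum.neutral) auto
    finally have "(\<Sum>i<Suc m. d i * l i) = 0"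
      using True by (intro Suc.prems(2)) simp
    then have lm: "l m = (\<Sum>i<m. l i * s i)"
      using d_lt[of l] by (simp add: d_def mult.commute)
    have "(\<Sum>j<m. G m j * r j) = (\<Sum>j<m. (\<Sum>k<m. G j k * s k) * r j)"
      using s sym by (intro sum.cong) auto
    also have "\<dots> = (\<Sum>k<m. (\<Sum>j<m. G k j * r j) * s k)"
      unfolding sum_distrib_right by (subst sum.swap) (simp add: sym mult_ac)
    also have "\<dots> = l m" unfolding lm using r by (intro sum.cong) auto
    finally have "\<forall>i<Suc m. (\<Sum>j<Suc m. G i j * (r(m := 0)) j) = l i"
      using r by (auto simp: less_Suc_eq)
    then show ?thesis by blast
  next
    case False
    \<comment> \<open>Adding a multiple of \<open>d\<close> leaves the first \<open>m\<close>
      equations intact; \<open>k\<close> is the defect of the last equation divided by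
      \<open>D\<close>.\<close>
    define k where "k = (l m - (\<Sum>j<m. G m j * r j)) / D"
    define c where "c j = (r(m := 0)) j + k * d j" for j
    have "(\<Sum>j<Suc m. G i j * c j) = (\<Sum>j<m. G i j * r j) + k * (\<Sum>j<Suc m. G i j * d j)" for i
      by (simp add: c_def algebra_simps sum.distrib sum_distrib_left)
    then have "\<forall>i<Suc m. (\<Sum>j<Suc m. G i j * c j) = l i"
      using r orth False by (auto simp: less_Suc_eq k_def D_def[symmetric] simp del: sum.lessThan_Suc)
    then show ?thesis by blast
  qed
qed

definition coercive_form :: "real \<Rightarrow> ('v::real_normed_vector \<Rightarrow> 'v \<Rightarrow> real) \<Rightarrow> bool" where
  "coercive_form c A \<longleftrightarrow> bounded_bilinear A \<and> (\<forall>u v. A u v = A v u) \<and> c > 0 \<and> (\<forall>u. c * (norm u)\<^sup>2 \<le> A u u)"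

lemma coercive_formD:
  assumes "coercive_form c A"
  shows "bounded_bilinear A" "A u v = A v u" "c > 0" "c * (norm u)\<^sup>2 \<le> A u u" "0 \<le> A u u"
proof -
  show "bounded_bilinear A" "A u v = A v u" "c > 0" and *: "c * (norm u)\<^sup>2 \<le> A u u"
    using assms by (auto simp: coercive_form_def)
  have "0 \<le> c * (norm u)\<^sup>2" using assms by (simp add: coercive_form_def)
  with * show "0 \<le> A u u" by linarith
qed

lemma nonneg_quadratic_discriminant:
  fixes a b c :: real
  assumes "\<And>s. 0 \<le> a - 2 * s * b + s\<^sup>2 * c"
  shows "b\<^sup>2 \<le> a * c"
proof (cases "c = 0")
  case True
  have "b = 0"
  proof (rule ccontr)
    assume "b \<noteq> 0"
    \<comment> \<open>At this \<open>s\<close> the expression equals -1.\<close>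
    then show False using assms[of "(a + 1) / (2 * b)"] True by simp
  qed
  then show ?thesis using True by simp
next
  case False
  have "c > 0"
  proof (rule ccontr)
    assume "\<not> c > 0"
    with False have "c < 0" by simp
    \<comment> \<open>Adding the hypothesis at \<open>s\<close> and \<open>-s\<close> cancels the
      linear term; below, \<open>s\<close> is chosen to make the value -1.\<close>
    have *: "0 \<le> a + s\<^sup>2 * c" for s
      using assms[of s] assms[of "-s", simplified] by linarith
    have "a \<ge> 0" using *[of 0] by simp
    have "(sqrt ((a + 1) / - c))\<^sup>2 = (a + 1) / - c"
      using \<open>a \<ge> 0\<close> \<open>c < 0\<close> by (intro real_sqrt_pow2 divide_nonneg_pos) auto
    then show False using *[of "sqrt ((a + 1) / - c)"] \<open>c < 0\<close> by simp
  qed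
  \<comment> \<open>The quadratic is evaluated at its minimiser \<open>b / c\<close>.\<close>
  have "0 \<le> c * (a - 2 * (b / c) * b + (b / c)\<^sup>2 * c)"
    using assms[of "b / c"] \<open>c > 0\<close> by simp
  also have "\<dots> = a * c - b\<^sup>2" using \<open>c > 0\<close> by (simp add: field_simps power2_eq_square)
  finally show ?thesis by simp
qed

text \<open>The energy of \<open>u - s *\<^sub>R v\<close> is a nonnegative quadratic in
  \<open>s\<close>, so the discriminant bound applies.\<close>

lemma L2_form_Cauchy_Schwarz:
  fixes A :: "'v::{real_normed_vector, second_countable_topology} \<Rightarrow> 'v \<Rightarrow> real"
  assumes A: "coercive_form c A" and u: "u \<in> L2 T" and v: "v \<in> L2 T"
  shows "(LINT t|time_meas T. A (u t) (v t))\<^sup>2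
    \<le> (LINT t|time_meas T. A (u t) (u t)) * (LINT t|time_meas T. A (v t) (v t))"
proof (rule nonneg_quadratic_discriminant)
  fix s
  note bb = coercive_formD(1)[OF A]
  note i = L2_form_integrable[OF bb u u] L2_form_integrable[OF bb u v] L2_form_integrable[OF bb v v]
  have "0 \<le> (LINT t|time_meas T. A (u t - s *\<^sub>R v t) (u t - s *\<^sub>R v t))"
    by (intro integral_nonneg_AE AE_I2 coercive_formD(5)[OF A])
  also have "(\<lambda>t. A (u t - s *\<^sub>R v t) (u t - s *\<^sub>R v t)) = (\<lambda>t. A (u t) (u t) - (2 * s) * A (u t) (v t) + s\<^sup>2 * A (v t) (v t))"
  proof
    fix t
    show "A (u t - s *\<^sub>R v t) (u t - s *\<^sub>R v t) = A (u t) (u t) - (2 * s) * A (u t) (v t) + s\<^sup>2 * A (v t) (v t)"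
      using coercive_formD(2)[OF A, of "v t" "u t"]
      by (simp add: bounded_bilinear.diff_left[OF bb] bounded_bilinear.diff_right[OF bb]
          bounded_bilinear.scaleR_left[OF bb] bounded_bilinear.scaleR_right[OF bb] power2_eq_square algebra_simps)
  qed
  also have "(LINT t|time_meas T. A (u t) (u t) - (2 * s) * A (u t) (v t) + s\<^sup>2 * A (v t) (v t))
    = (LINT t|time_meas T. A (u t) (u t)) - 2 * s * (LINT t|time_meas T. A (u t) (v t)) + s\<^sup>2 * (LINT t|time_meas T. A (v t) (v t))"
    using i by simp
  finally show "0 \<le> (LINT t|time_meas T. A (u t) (u t)) - 2 * s * (LINT t|time_meas T. A (u t) (v t)) + s\<^sup>2 * (LINT t|time_meas T. A (v t) (v t))" .
qed

lemma L2_form_definite: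
  fixes A :: "'v::{real_normed_vector, second_countable_topology} \<Rightarrow> 'v \<Rightarrow> real"
  assumes A: "coercive_form c A" and u: "u \<in> L2 T" and zero: "(LINT t|time_meas T. A (u t) (u t)) = 0"
  shows "AE t in time_meas T. u t = 0"
proof -
  have "AE t in time_meas T. A (u t) (u t) = 0"
    using zero coercive_formD(5)[OF A] L2_form_integrable[OF coercive_formD(1)[OF A] u u]
    by (subst (asm) integral_nonneg_eq_0_iff_AE) auto
  then show ?thesis
  proof eventually_elim
    case (elim t)
    then have "c * (norm (u t))\<^sup>2 \<le> 0" using coercive_formD(4)[OF A, of "u t"] by simp
    then show "u t = 0"
      using coercive_formD(3)[OF A] by (simp add: mult_le_0_iff)
  qed
qed

text \<open>The functional may vary with \<open>t\<close>, so that both \<open>A (u t)\<close> and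
  the pairing with \<open>g t\<close> are instances.\<close>

lemma integral_linear_expansion:
  fixes B :: "real \<Rightarrow> 'v::{real_normed_vector, second_countable_topology} \<Rightarrow> real"
  assumes B: "\<And>u. u \<in> L2 T \<Longrightarrow> integrable (time_meas T) (\<lambda>t. B t (u t))" "\<And>t. linear (B t)"
    and q: "q \<in> L2 T" "AE t in time_meas T. q t = (\<Sum>k<m. c k *\<^sub>R e k t)"
    and e: "\<And>k. k < m \<Longrightarrow> e k \<in> L2 T"
  shows "(LINT t|time_meas T. B t (q t)) = (\<Sum>k<m. c k * (LINT t|time_meas T. B t (e k t)))"
proof -
  have i: "integrable (time_meas T) (\<lambda>t. c k * B t (e k t))" if "k < m" for k
    using B(1)[OF e[OF that]] by simp
  have "AE t in time_meas T. B t (q t) = (\<Sum>k<m. c k * B t (e k t))"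
    using q(2) by eventually_elim (simp add: linear_sum[OF B(2)] linear_cmul[OF B(2)])
  then have "(LINT t|time_meas T. B t (q t)) = (LINT t|time_meas T. (\<Sum>k<m. c k * B t (e k t)))"
    using i by (intro integral_cong_AE borel_measurable_integrable B q) auto
  then show ?thesis using i by simp
qed

context space_time
begin

lemma basis_L2: "k < P * N \<Longrightarrow> tensor_basis N \<psi> \<phi> k \<in> L2 T"
proof -
  assume "k < P * N"
  then have "(\<lambda>t. \<Sum>i<Suc 0. \<psi> (k div N) t *\<^sub>R \<phi> (k mod N)) \<in> L2 T"
    by (intro L2_coefficients psi_L2 div_less)
  then show ?thesis by (simp add: tensor_basis_def[abs_def])
qed

text \<open>The coefficients solve the Gram system with right-hand side \<open>l\<close>. By
  coercivity a coefficient vector of zero energy represents a function that vanishes almost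
  everywhere, which gives both conditions of \<open>gram_solvable\<close>.\<close>

lemma riesz_lift_exists:
  assumes A: "coercive_form \<gamma> A" and g: "g \<in> L2 T"
  shows "\<exists>r. r \<in> Qd \<and> (\<forall>q\<in>Qd. (LINT t|time_meas T. A (r t) (q t)) = (LINT t|time_meas T. blinfun_apply (g t) (q t)))"
proof -
  let ?e = "tensor_basis N \<psi> \<phi>" and ?n = "P * N"
  note bb = coercive_formD(1)[OF A]
  define G where "G i j = (LINT t|time_meas T. A (?e i t) (?e j t))" for i j
  define l where "l i = (LINT t|time_meas T. g t (?e i t))" for i
  \<comment> \<open>A partial combination is padded with zero coefficients to one over the whole
    basis.\<close>
  have comb: "(\<lambda>t. \<Sum>k<m. c k *\<^sub>R ?e k t) \<in> L2 T" if "m \<le> ?n" for m c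
  proof -
    have "(\<lambda>t. \<Sum>k<?n. (if k < m then c k else 0) *\<^sub>R ?e k t) \<in> L2 T"
      by (rule Qd_L2[OF Qd_combination])
    also have "(\<lambda>t. \<Sum>k<?n. (if k < m then c k else 0) *\<^sub>R ?e k t) = (\<lambda>t. \<Sum>k<m. c k *\<^sub>R ?e k t)"
      using that by (intro ext sum.mono_neutral_cong_right) auto
    finally show ?thesis .
  qed
  have A_exp: "(LINT t|time_meas T. A (u t) (q t)) = (\<Sum>k<m. c k * (LINT t|time_meas T. A (u t) (?e k t)))"
    if "u \<in> L2 T" "q \<in> L2 T" "AE t in time_meas T. q t = (\<Sum>k<m. c k *\<^sub>R ?e k t)" "m \<le> ?n" for u q m c
    using that bounded_linear.linear[OF bounded_bilinear.bounded_linear_right[OF bb]]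
    by (intro integral_linear_expansion L2_form_integrable bb basis_L2) auto
  have g_exp: "(LINT t|time_meas T. g t (q t)) = (\<Sum>k<m. c k * l k)"
    if "q \<in> L2 T" "AE t in time_meas T. q t = (\<Sum>k<m. c k *\<^sub>R ?e k t)" "m \<le> ?n" for q m c
    unfolding l_def using that g bounded_linear.linear[OF blinfun.bounded_linear_right]
    by (intro integral_linear_expansion L2_pairing_integrable basis_L2) auto
  have G_sym: "G i j = G j i" for i j
    unfolding G_def using coercive_formD(2)[OF A] by simp
  have comb_G: "(LINT t|time_meas T. A (\<Sum>k<m. c k *\<^sub>R ?e k t) (?e j t)) = (\<Sum>k<m. c k * G k j)"
    if "m \<le> ?n" "j < ?n" for m c j
  proof -
    have "(LINT t|time_meas T. A (\<Sum>k<m. c k *\<^sub>R ?e k t) (?e j t))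
        = (LINT t|time_meas T. A (?e j t) (\<Sum>k<m. c k *\<^sub>R ?e k t))"
      using coercive_formD(2)[OF A] by simp
    also have "\<dots> = (\<Sum>k<m. c k * G j k)"
      unfolding G_def using that by (intro A_exp comb basis_L2) auto
    finally show ?thesis using G_sym by simp
  qed
  have zero: "AE t in time_meas T. (\<Sum>k<m. c k *\<^sub>R ?e k t) = 0"
    if m: "m \<le> ?n" and c: "(\<Sum>i<m. \<Sum>j<m. c i * c j * G i j) = 0" for m c
  proof (rule L2_form_definite[OF A comb[OF m]])
    have "(LINT t|time_meas T. A (\<Sum>k<m. c k *\<^sub>R ?e k t) (\<Sum>k<m. c k *\<^sub>R ?e k t))
        = (\<Sum>j<m. c j * (\<Sum>i<m. c i * G i j))"
      using m comb_G[OF m] by (subst A_exp[OF comb[OF m] comb[OF m] _ m]) (auto intro!: sum.cong)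
    also have "\<dots> = (\<Sum>j<m. \<Sum>i<m. c i * c j * G i j)"
      by (simp add: sum_distrib_left mult_ac)
    also have "\<dots> = 0" using c by (subst sum.swap)
    finally show "(LINT t|time_meas T. A (\<Sum>k<m. c k *\<^sub>R ?e k t) (\<Sum>k<m. c k *\<^sub>R ?e k t)) = 0" .
  qed
  have "\<exists>c. \<forall>i<?n. (\<Sum>j<?n. G i j * c j) = l i"
  proof (rule gram_solvable[OF G_sym])
    fix m c j assume m: "m \<le> ?n" and j: "j < ?n" and c: "(\<Sum>i<m. \<Sum>j<m. c i * c j * G i j) = 0"
    have "(\<Sum>i<m. c i * G i j) = (LINT t|time_meas T. A (\<Sum>k<m. c k *\<^sub>R ?e k t) (?e j t))"
      by (rule comb_G[OF m j, symmetric])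
    also have "\<dots> = 0"
      using zero[OF m c] by (intro integral_eq_zero_AE) (auto simp: bounded_bilinear.zero_left[OF bb] elim!: eventually_mono)
    finally show "(\<Sum>i<m. c i * G i j) = 0" .
  next
    fix c assume c: "(\<Sum>i<?n. \<Sum>j<?n. c i * c j * G i j) = 0"
    have "(\<Sum>i<?n. c i * l i) = (LINT t|time_meas T. g t (\<Sum>k<?n. c k *\<^sub>R ?e k t))"
      by (rule g_exp[OF comb _ order_refl, symmetric]) auto
    also have "\<dots> = 0"
      using zero[OF order_refl c] by (intro integral_eq_zero_AE) (auto elim!: eventually_mono)
    finally show "(\<Sum>i<?n. c i * l i) = 0" .
  qed simp
  then obtain c where c: "\<And>i. i < ?n \<Longrightarrow> (\<Sum>j<?n. G i j * c j) = l i" by blast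
  define r where "r t = (\<Sum>k<?n. c k *\<^sub>R ?e k t)" for t
  have "r \<in> Qd" unfolding r_def[abs_def] by (rule Qd_combination)
  moreover have "(LINT t|time_meas T. A (r t) (q t)) = (LINT t|time_meas T. g t (q t))" if q: "q \<in> Qd" for q
  proof -
    obtain d where d: "AE t in time_meas T. q t = (\<Sum>k<?n. d k *\<^sub>R ?e k t)"
      using q by (auto simp: tensor_space_def L2_span_def)
    have "(LINT t|time_meas T. A (r t) (q t)) = (\<Sum>k<?n. d k * (LINT t|time_meas T. A (r t) (?e k t)))"
      by (rule A_exp[OF Qd_L2[OF \<open>r \<in> Qd\<close>] Qd_L2[OF q] d order_refl])
    also have "\<dots> = (\<Sum>k<?n. d k * l k)"
      unfolding r_def using comb_G[OF order_refl] c G_sym by (intro sum.cong) (auto simp: mult.commute)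
    also have "\<dots> = (LINT t|time_meas T. g t (q t))"
      by (rule g_exp[OF Qd_L2[OF q] d order_refl, symmetric])
    finally show ?thesis .
  qed
  ultimately show ?thesis by blast
qed

abbreviation "lift A w \<equiv> riesz_lift T Qd A (tderiv w)"

lemma lift_props:
  assumes A: "coercive_form \<gamma> A" and w: "w \<in> Wd"
  shows "lift A w \<in> Qd"
    and "q \<in> Qd \<Longrightarrow> (LINT t|time_meas T. A (lift A w t) (q t)) = (LINT t|time_meas T. tderiv w t (q t))"
  using someI_ex[OF riesz_lift_exists[OF A Wd_time_deriv(1)[OF w]]] by (auto simp: riesz_lift_def)

section \<open>The discrete form\<close>

text \<open>The lift of \<open>w\<close> lies in \<open>Qd\<close> and may test the equation that
  defines the lift of \<open>v\<close>. The first argument then enters through its time derivative,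
  so linearity in it follows from \<open>time_deriv_diff_pairing\<close>.\<close>

lemma b_disc_alt:
  assumes A: "coercive_form \<gamma> A" and v: "v \<in> Wd" and w: "w \<in> Wd"
  shows "b_disc T \<iota> Qd A v w = (LINT t|time_meas T. tderiv v t (lift A w t))
    + (LINT t|time_meas T. A (v t) (w t)) + inner (tr v T) (tr w T)"
  using lift_props(2)[OF A v lift_props(1)[OF A w]] by (simp add: b_disc_def)

lemma b_disc_sym:
  assumes A: "coercive_form \<gamma> A"
  shows "b_disc T \<iota> Qd A v w = b_disc T \<iota> Qd A w v"
  using coercive_formD(2)[OF A] by (simp add: b_disc_def inner_commute)

lemma b_disc_diff_left:
  assumes A: "coercive_form \<gamma> A" and u: "u \<in> Wd" and v: "v \<in> Wd" and w: "w \<in> Wd"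
  shows "b_disc T \<iota> Qd A (\<lambda>t. u t - v t) w = b_disc T \<iota> Qd A u w - b_disc T \<iota> Qd A v w"
proof -
  note bb = coercive_formD(1)[OF A]
  have "(LINT t|time_meas T. A (u t - v t) (w t)) = (LINT t|time_meas T. A (u t) (w t)) - (LINT t|time_meas T. A (v t) (w t))"
    using L2_form_integrable[OF bb Wd_L2[OF u] Wd_L2[OF w]] L2_form_integrable[OF bb Wd_L2[OF v] Wd_L2[OF w]]
    by (simp add: bounded_bilinear.diff_left[OF bb])
  moreover have "tr (\<lambda>t. u t - v t) T = tr u T - tr v T"
    using T_pos by (intro trace_diff u v) simp
  ultimately show ?thesis
    using time_deriv_diff_pairing[OF u v lift_props(1)[OF A w]]
    by (simp add: b_disc_alt[OF A Wd_diff[OF u v] w] b_disc_alt[OF A u w] b_disc_alt[OF A v w] inner_diff_left)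
qed

lemma form_integral_nonneg:
  assumes A: "coercive_form \<gamma> A"
  shows "0 \<le> (LINT t|time_meas T. A (u t) (u t))"
  by (intro integral_nonneg_AE AE_I2 coercive_formD(5)[OF A])

lemma b_disc_nonneg:
  assumes A: "coercive_form \<gamma> A"
  shows "0 \<le> b_disc T \<iota> Qd A w w"
  unfolding b_disc_def by (intro add_nonneg_nonneg form_integral_nonneg[OF A]) simp

lemma b_disc_Cauchy_Schwarz:
  assumes A: "coercive_form \<gamma> A" and v: "v \<in> Wd" and w: "w \<in> Wd"
  shows "b_disc T \<iota> Qd A v w \<le> sqrt (b_disc T \<iota> Qd A v v) * sqrt (b_disc T \<iota> Qd A w w)"
proof -
  let ?I = "\<lambda>p q. LINT t|time_meas T. A (p t) (q t)"
  have CS: "?I p q \<le> sqrt (?I p p) * sqrt (?I q q)" if "p \<in> L2 T" "q \<in> L2 T" for p q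
  proof -
    have "sqrt ((?I p q)\<^sup>2) \<le> sqrt (?I p p * ?I q q)"
      by (intro real_sqrt_le_mono L2_form_Cauchy_Schwarz[OF A that])
    then show ?thesis by (simp add: real_sqrt_mult)
  qed
  \<comment> \<open>Cauchy-Schwarz in three dimensions, with nested pairs as vectors, joins the
    estimates of the three terms of \<open>b_disc\<close>.\<close>
  have three: "a * d + b * e + c * f \<le> sqrt (a\<^sup>2 + b\<^sup>2 + c\<^sup>2) * sqrt (d\<^sup>2 + e\<^sup>2 + f\<^sup>2)" for a b c d e f :: real
    using norm_cauchy_schwarz[of "(a, b, c)" "(d, e, f)"] by (simp add: norm_Pair add.assoc)
  have L: "lift A v \<in> L2 T" "lift A w \<in> L2 T" using lift_props(1)[OF A] v w Qd_L2 by auto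
  have "b_disc T \<iota> Qd A v w \<le> sqrt (?I (lift A v) (lift A v)) * sqrt (?I (lift A w) (lift A w))
      + sqrt (?I v v) * sqrt (?I w w) + norm (tr v T) * norm (tr w T)"
    unfolding b_disc_def by (intro add_mono CS L Wd_L2 v w norm_cauchy_schwarz)
  also note three
  finally show ?thesis
    unfolding b_disc_def by (simp add: form_integral_nonneg[OF A] power2_norm_eq_inner)
qed

text \<open>The second equation is tested with the lift of \<open>w\<^sub>t\<close>, which eliminates the multiplier \<open>p\<close>.\<close>

lemma solves_problem_imp_b_disc:
  assumes A: "coercive_form \<gamma> A" and sol: "solves_problem T \<iota> A y0 f Wd Qd y p" and w: "w \<in> Wd"
  shows "b_disc T \<iota> Qd A y w = l_disc T \<iota> Qd A y0 f w"
proof -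
  have y: "y \<in> Wd" and p: "p \<in> Qd" using sol by (auto simp: solves_problem_def)
  note R = lift_props(1)[OF A w]
  have "b_hat T \<iota> w p = (LINT t|time_meas T. A (lift A w t) (p t))"
    using lift_props(2)[OF A w p] by (simp add: b_hat_def)
  also have "\<dots> = c_hat T A p (lift A w)"
    using coercive_formD(2)[OF A] by (simp add: c_hat_def)
  also have "\<dots> = b_hat T \<iota> y (lift A w) - l2_hat T f (lift A w)"
    using sol R by (auto simp: solves_problem_def)
  finally have "a_hat T \<iota> A y w + (b_hat T \<iota> y (lift A w) - l2_hat T f (lift A w)) = l1_hat T \<iota> y0 f w"
    using sol w by (auto simp: solves_problem_def)
  then show ?thesis
    by (simp add: b_disc_alt[OF A y w] l_disc_def a_hat_def b_hat_def l1_hat_def l2_hat_def)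
qed

text \<open>The time family \<open>b\<close> is arbitrary because the bound serves functions of
  \<open>Wd\<close> as well as lifts in \<open>Qd\<close>.\<close>

lemma form_integral_mono:
  fixes A B :: "'v \<Rightarrow> 'v \<Rightarrow> real"
  assumes A: "bounded_bilinear A" and B: "bounded_bilinear B" and N: "N > 0"
    and w: "w \<in> tensor_space T m N b \<phi>"
    and le: "\<And>v. v \<in> span (\<phi> ` {..<N}) \<Longrightarrow> c * A v v \<le> B v v"
  shows "c * (LINT t|time_meas T. A (w t) (w t)) \<le> (LINT t|time_meas T. B (w t) (w t))"
proof -
  have L: "w \<in> L2 T" using w by (simp add: tensor_space_def L2_span_def)
  have "(LINT t|time_meas T. c * A (w t) (w t)) \<le> (LINT t|time_meas T. B (w t) (w t))"
  proof (rule integral_mono_AE)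
    show "AE t in time_meas T. c * A (w t) (w t) \<le> B (w t) (w t)"
      using tensor_space_in_span[OF N w] by eventually_elim (rule le)
  qed (use L2_form_integrable[OF A L L] L2_form_integrable[OF B L L] in auto)
  then show ?thesis by simp
qed

text \<open>The terms are compared one by one: \<open>lower\<close> treats the middle one,
  \<open>\<alpha> \<le> 1\<close> the trace. The lift is taken with respect to different forms on
  the two sides, so its term needs a duality argument that uses \<open>upper\<close>.\<close>

lemma b_disc_lower_bound:
  assumes A: "coercive_form \<gamma> A" and B: "coercive_form \<delta> B" and N: "N > 0"
    and \<alpha>: "0 < \<alpha>" "\<alpha> \<le> 1"
    and lower: "\<And>v. v \<in> span (\<phi> ` {..<N}) \<Longrightarrow> \<alpha> * B v v \<le> A v v"
    and upper: "\<And>v. v \<in> span (\<phi> ` {..<N}) \<Longrightarrow> \<alpha> * A v v \<le> B v v"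
    and w: "w \<in> Wd"
  shows "\<alpha> * b_disc T \<iota> Qd B w w \<le> b_disc T \<iota> Qd A w w"
proof -
  note bbA = coercive_formD(1)[OF A] and bbB = coercive_formD(1)[OF B]
  note RA = lift_props(1)[OF A w] and RB = lift_props(1)[OF B w]
  define X where "X = (LINT t|time_meas T. A (lift A w t) (lift A w t))"
  define Y where "Y = (LINT t|time_meas T. B (lift B w t) (lift B w t))"
  define Z where "Z = (LINT t|time_meas T. A (lift B w t) (lift B w t))"
  have "X \<ge> 0" "Y \<ge> 0"
    unfolding X_def Y_def by (rule form_integral_nonneg[OF A] form_integral_nonneg[OF B])+
  \<comment> \<open>Both sides are the pairing of the time derivative of \<open>w\<close> with
    \<open>lift B w\<close>.\<close>
  have "Y = (LINT t|time_meas T. A (lift A w t) (lift B w t))"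
    unfolding Y_def lift_props(2)[OF B w RB] lift_props(2)[OF A w RB] ..
  then have "Y\<^sup>2 \<le> X * Z"
    unfolding X_def Z_def using L2_form_Cauchy_Schwarz[OF A Qd_L2[OF RA] Qd_L2[OF RB]] by simp
  then have "\<alpha> * Y\<^sup>2 \<le> X * (\<alpha> * Z)" using \<alpha> by (simp add: mult.left_commute)
  also have "\<dots> \<le> X * Y"
    unfolding Y_def Z_def using \<open>X \<ge> 0\<close>
    by (intro mult_left_mono form_integral_mono[OF bbA bbB N RB upper])
  \<comment> \<open>One factor \<open>Y\<close> is cancelled; if it is zero, the claim is just
    \<open>X \<ge> 0\<close>.\<close>
  finally have "\<alpha> * Y \<le> X"
    using \<open>X \<ge> 0\<close> \<open>Y \<ge> 0\<close> by (cases "Y = 0") (simp_all add: power2_eq_square)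
  moreover have "\<alpha> * (LINT t|time_meas T. B (w t) (w t)) \<le> (LINT t|time_meas T. A (w t) (w t))"
    by (rule form_integral_mono[OF bbB bbA N w lower])
  moreover have "\<alpha> * inner (tr w T) (tr w T) \<le> 1 * inner (tr w T) (tr w T)"
    using \<alpha> by (intro mult_right_mono) auto
  ultimately show ?thesis
    unfolding b_disc_def X_def Y_def by (simp add: distrib_left)
qed

end

section \<open>The constant of the estimate\<close>

text \<open>The constants \<open>c\<close> and \<open>C\<close> bound the quotients, so infimum and
  suprema are genuine. The nonzero \<open>x\<close> keeps their ranges nonempty and yields
  \<open>?cc \<le> ?cs\<close>, whence \<open>?cc\<close> and \<open>1 / ?cs\<close> cannot both
  exceed 1.\<close>

lemma alpha_const_bounds:
  fixes A :: "'v::real_normed_vector \<Rightarrow> 'v \<Rightarrow> real"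
  assumes A: "coercive_form c A" and bound: "\<And>u v. \<bar>A u v\<bar> \<le> C * norm u * norm v"
    and U: "x \<in> U" "x \<noteq> 0"
  shows "0 < alpha_const U A" "alpha_const U A \<le> 1"
    and "v \<in> U \<Longrightarrow> alpha_const U A * (norm v)\<^sup>2 \<le> A v v"
    and "v \<in> U \<Longrightarrow> alpha_const U A * A v v \<le> (norm v)\<^sup>2"
proof -
  let ?cc = "coercivity_const U A" and ?cs = "continuity_const U A"
  have ne: "U - {0} \<noteq> {}" using U by auto
  have quot_le: "A u v / (norm u * norm v) \<le> C" if "u \<in> U - {0}" "v \<in> U - {0}" for u v
    using bound[of u v] that by (simp add: divide_le_eq mult.assoc abs_le_iff)
  have le_quot: "c \<le> A v v / (norm v)\<^sup>2" if "v \<in> U - {0}" for v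
    using coercive_formD(4)[OF A, of v] that by (simp add: le_divide_eq)
  have inner_bdd: "bdd_above ((\<lambda>v. A u v / (norm u * norm v)) ` (U - {0}))" if "u \<in> U - {0}" for u
    using quot_le[OF that] by (intro bdd_aboveI[of _ C]) auto
  have "c \<le> ?cc" unfolding coercivity_const_def by (intro cINF_greatest ne le_quot)
  then have cc_pos: "?cc > 0" using coercive_formD(3)[OF A] by simp
  have cc_le: "?cc \<le> A v v / (norm v)\<^sup>2" if "v \<in> U - {0}" for v
    unfolding coercivity_const_def using that le_quot by (intro cINF_lower bdd_belowI[of _ c]) auto
  \<comment> \<open>The double supremum is bounded below by its diagonal values.\<close>
  have le_cs: "A v v / (norm v)\<^sup>2 \<le> ?cs" if v: "v \<in> U - {0}" for v
  proof -
    have "A v v / (norm v * norm v) \<le> (SUP w\<in>U - {0}. A v w / (norm v * norm w))"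
      by (rule cSUP_upper[OF v inner_bdd[OF v]])
    also have "\<dots> \<le> ?cs"
      unfolding continuity_const_def
    proof (rule cSUP_upper[OF v])
      show "bdd_above ((\<lambda>u. SUP v\<in>U - {0}. A u v / (norm u * norm v)) ` (U - {0}))"
        using quot_le by (intro bdd_aboveI[of _ C]) (auto intro!: cSUP_least ne)
    qed
    finally show ?thesis by (simp add: power2_eq_square)
  qed
  have "x \<in> U - {0}" using U by simp
  from cc_le[OF this] le_cs[OF this] have cc_cs: "?cc \<le> ?cs" by simp
  then have cs_pos: "?cs > 0" using cc_pos by simp
  show pos: "0 < alpha_const U A" using cc_pos cs_pos by (simp add: alpha_const_def)
  show "alpha_const U A \<le> 1"
  proof (cases "?cs \<ge> 1")
    case True
    then have "1 / ?cs \<le> 1" by simp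
    then show ?thesis by (simp add: alpha_const_def min.coboundedI2)
  next
    case False
    then show ?thesis using cc_cs by (simp add: alpha_const_def min.coboundedI1)
  qed
  have zero: "A 0 0 = 0" using bound[of 0 0] by simp
  show "alpha_const U A * (norm v)\<^sup>2 \<le> A v v" if "v \<in> U"
  proof (cases "v = 0")
    case False
    have "alpha_const U A * (norm v)\<^sup>2 \<le> ?cc * (norm v)\<^sup>2"
      by (intro mult_right_mono) (auto simp: alpha_const_def)
    also have "\<dots> \<le> A v v" using cc_le[of v] that False by (simp add: le_divide_eq)
    finally show ?thesis .
  qed (simp add: zero)
  show "alpha_const U A * A v v \<le> (norm v)\<^sup>2" if "v \<in> U"
  proof (cases "v = 0")
    case False
    have "alpha_const U A * A v v \<le> 1 / ?cs * (?cs * (norm v)\<^sup>2)"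
    proof (rule mult_mono)
      show "alpha_const U A \<le> 1 / ?cs" by (simp add: alpha_const_def)
      show "A v v \<le> ?cs * (norm v)\<^sup>2" using le_cs[of v] that False by (simp add: divide_le_eq)
    qed (use cs_pos coercive_formD(5)[OF A] in auto)
    then show ?thesis using cs_pos by simp
  qed (simp add: zero)
qed

section \<open>The error bound\<close>

text \<open>Functions stand for classes modulo null sets, so a nonzero \<open>yrb\<close> is one
  that does not vanish almost everywhere.\<close>

theorem theorem5p1:
  fixes \<iota> :: "'v::{real_inner,complete_space,second_countable_topology} \<Rightarrow>\<^sub>L
                'h::{real_inner,complete_space,second_countable_topology}"
    and Par :: "'p set" and \<mu>ref \<mu> :: 'p
    and a :: "'p \<Rightarrow> 'v \<Rightarrow> 'v \<Rightarrow> real"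
    and cs cc T :: real
    and y0 :: "'p \<Rightarrow> 'h" and f :: "'p \<Rightarrow> real \<Rightarrow> 'v \<Rightarrow>\<^sub>L real"
    and P M N L :: nat
    and \<psi> chi :: "nat \<Rightarrow> real \<Rightarrow> real" and \<phi> :: "nat \<Rightarrow> 'v"
    and \<xi> :: "nat \<Rightarrow> real \<Rightarrow> 'v" and BW :: "real mat"
    and yd pd yrb prb rt :: "real \<Rightarrow> 'v"
  defines "VN \<equiv> span (\<phi> ` {..<N})"
    and "JP \<equiv> L2_span T P \<psi>"
    and "Wd \<equiv> tensor_space T M N chi \<phi>"
    and "Qd \<equiv> tensor_space T P N \<psi> \<phi>"
    and "WL \<equiv> L2_span T L \<xi>"
    and "QK \<equiv> L2_span T L (column_function (P * N) (tensor_basis N \<psi> \<phi>)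
                 (BQ_mat T \<iota> (a \<mu>ref) P M N \<psi> chi \<phi> BW))"
    and "nrmW \<equiv> Wd_norm T \<iota> (tensor_space T P N \<psi> \<phi>) (a \<mu>ref)"
  defines "eta_abs \<equiv> nrmW rt / alpha_const VN (a \<mu>)"
    and "eta_rel \<equiv> 2 * nrmW rt / (alpha_const VN (a \<mu>) * nrmW yrb)"
  assumes gelfand: "gelfand_triple \<iota>"
    and form: "\<And>\<nu>. \<nu> \<in> Par \<Longrightarrow> bilinear (a \<nu>)"
      "\<And>\<nu> u v. \<nu> \<in> Par \<Longrightarrow> a \<nu> u v = a \<nu> v u"
    and positive: "cs > 0" "cc > 0"
    and bounded: "\<And>\<nu> u v. \<nu> \<in> Par \<Longrightarrow> \<bar>a \<nu> u v\<bar> \<le> cs * norm u * norm v"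
    and coercive: "\<And>\<nu> u. \<nu> \<in> Par \<Longrightarrow> a \<nu> u u \<ge> cc * (norm u)\<^sup>2"
    and reference: "\<mu>ref \<in> Par" "\<And>u v. inner u v = a \<mu>ref u v"
    and time: "T > 0"
    and rhs: "\<And>\<nu>. \<nu> \<in> Par \<Longrightarrow> f \<nu> \<in> L2 T"
      "\<exists>C. \<forall>\<nu>\<in>Par. L2_norm T (f \<nu>) \<le> C"
    and basis_J: "\<And>p. p < P \<Longrightarrow> \<psi> p \<in> L2 T" "L2_independent T P \<psi>"
    and basis_K: "\<And>m. m < M \<Longrightarrow> chi m \<in> H1 T" "\<And>m. m < M \<Longrightarrow> weak_deriv T (chi m) \<in> JP"
      "L2_independent T M chi"
    and basis_V: "N > 0" "inj_on \<phi> {..<N}" "independent (\<phi> ` {..<N})"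
    and reduced_basis: "\<And>l. l < L \<Longrightarrow> \<xi> l \<in> Wd" "L2_independent T L \<xi>"
    and BW: "BW \<in> carrier_mat (M * N) L"
      "\<And>l. l < L \<Longrightarrow>
         AE t in time_meas T. \<xi> l t = column_function (M * N) (tensor_basis N chi \<phi>) BW l t"
    and \<mu>: "\<mu> \<in> Par"
    and high_fidelity: "solves_problem T \<iota> (a \<mu>) (y0 \<mu>) (f \<mu>) Wd Qd yd pd"
    and reduced: "solves_problem T \<iota> (a \<mu>) (y0 \<mu>) (f \<mu>) WL QK yrb prb"
    and riesz: "rt \<in> Wd"
      "\<And>w. w \<in> Wd \<Longrightarrow>
         b_disc T \<iota> Qd (a \<mu>ref) rt w = res_disc T \<iota> Qd (a \<mu>) (y0 \<mu>) (f \<mu>) yrb w"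
  shows "nrmW (\<lambda>t. yd t - yrb t) \<le> eta_abs \<and>
    (\<not> (AE t in time_meas T. yrb t = 0) \<longrightarrow> eta_rel \<le> 1 \<longrightarrow>
       nrmW (\<lambda>t. yd t - yrb t) / nrmW yd \<le> eta_rel)"
proof -
  interpret space_time \<iota> T P M N \<psi> chi \<phi>
    by unfold_locales (use time basis_J basis_K in auto)
  let ?B = "a \<mu>ref" and ?A = "a \<mu>"
  have coercive_forms: "coercive_form cc (a \<nu>)" if "\<nu> \<in> Par" for \<nu>
    unfolding coercive_form_def
  proof (intro conjI allI)
    have "norm (a \<nu> u v) \<le> norm u * norm v * cs" for u v
      using bounded[OF that, of u v] by (simp add: mult_ac)
    then show "bounded_bilinear (a \<nu>)"
      using form(1)[OF that]
      by unfold_locales (auto simp: bilinear_ladd bilinear_radd bilinear_lmul bilinear_rmul)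
  qed (use form(2) coercive positive that in auto)
  note A = coercive_forms[OF \<mu>] and B = coercive_forms[OF reference(1)]
  \<comment> \<open>The norm in \<open>alpha_const\<close> is the energy norm of the reference form,
    so the bounds on \<open>alpha_const\<close> compare \<open>?A\<close> with
    \<open>?B\<close>.\<close>
  have B_norm: "?B v v = (norm v)\<^sup>2" for v
    using reference(2)[of v v] by (simp add: power2_norm_eq_inner)
  define \<alpha> where "\<alpha> = alpha_const VN ?A"
  \<comment> \<open>An independent set excludes 0, so \<open>\<phi> 0\<close> is the nonzero vector
    that \<open>alpha_const_bounds\<close> asks for.\<close>
  have "0 \<notin> \<phi> ` {..<N}"
    using dependent_zero[of "\<phi> ` {..<N}"] basis_V(3) by auto
  then have "\<phi> 0 \<in> VN" "\<phi> 0 \<noteq> 0"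
    using basis_V(1) unfolding VN_def by (auto intro: span_base)
  note alpha_bounds = alpha_const_bounds[OF A bounded[OF \<mu>] this, folded \<alpha>_def]
  note \<alpha> = alpha_bounds(1,2)
  have "\<And>l. l < L \<Longrightarrow> \<xi> l \<in> L2_span T (M * N) (tensor_basis N chi \<phi>)"
    using reduced_basis(1) unfolding Wd_def tensor_space_def by blast
  \<comment> \<open>Hence the error lies in the high fidelity space and may itself serve as test
    function.\<close>
  then have "WL \<subseteq> tensor_space T M N chi \<phi>"
    unfolding WL_def tensor_space_def by (rule L2_span_subset)
  then have yrb: "yrb \<in> tensor_space T M N chi \<phi>" using reduced by (auto simp: solves_problem_def)
  have yd: "yd \<in> tensor_space T M N chi \<phi>" using high_fidelity unfolding Wd_def by (simp add: solves_problem_def)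
  have rt: "rt \<in> tensor_space T M N chi \<phi>" using riesz(1) unfolding Wd_def .
  define e where "e = (\<lambda>t. yd t - yrb t)"
  have e: "e \<in> tensor_space T M N chi \<phi>" unfolding e_def by (rule Wd_diff[OF yd yrb])
  let ?b = "b_disc T \<iota> (tensor_space T P N \<psi> \<phi>)"
  have nrm_sq: "(nrmW w)\<^sup>2 = ?b ?B w w" for w
    unfolding nrmW_def Wd_norm_def using b_disc_nonneg[OF B] by simp
  have nrm_nonneg: "nrmW w \<ge> 0" for w
    unfolding nrmW_def Wd_norm_def using b_disc_nonneg[OF B] by simp
  have CS: "?b ?B v w \<le> nrmW v * nrmW w"
    if "v \<in> tensor_space T M N chi \<phi>" "w \<in> tensor_space T M N chi \<phi>" for v w
    unfolding nrmW_def Wd_norm_def by (rule b_disc_Cauchy_Schwarz[OF B that])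
  have "\<alpha> * (nrmW e)\<^sup>2 \<le> ?b ?A e e"
    unfolding nrm_sq
    by (rule b_disc_lower_bound[OF A B basis_V(1) \<alpha> _ _ e])
      (use alpha_bounds(3,4) in \<open>auto simp: B_norm VN_def\<close>)
  also have "?b ?A e e = ?b ?A yd e - ?b ?A yrb e"
    unfolding e_def by (rule b_disc_diff_left[OF A yd yrb Wd_diff[OF yd yrb]])
  \<comment> \<open>The high fidelity equation turns the first term into \<open>l_disc\<close>, so
    the difference is the residual at \<open>e\<close>.\<close>
  also have "\<dots> = ?b ?B rt e"
    using riesz(2)[of e] e solves_problem_imp_b_disc[OF A _ e, of "y0 \<mu>" "f \<mu>" yd pd] high_fidelity
    unfolding Wd_def Qd_def res_disc_def by simp
  also have "\<dots> \<le> nrmW rt * nrmW e" by (rule CS[OF rt e])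
  finally have "\<alpha> * nrmW e \<le> nrmW rt"
    using nrm_nonneg[of e] nrm_nonneg[of rt]
    by (cases "nrmW e = 0") (simp_all add: power2_eq_square)
  then have abs_bound: "nrmW e \<le> eta_abs"
    using \<alpha>(1) unfolding eta_abs_def \<alpha>_def[symmetric] by (simp add: le_divide_eq mult.commute)
  moreover have "nrmW e / nrmW yd \<le> eta_rel"
    if nonzero: "\<not> (AE t in time_meas T. yrb t = 0)" and small: "eta_rel \<le> 1"
  proof -
    \<comment> \<open>Positivity of the norm is read off the middle term of \<open>b_disc\<close>,
      which is definite on classes modulo null sets.\<close>
    have "?b ?B yrb yrb \<ge> (LINT t|time_meas T. ?B (yrb t) (yrb t))"
      unfolding b_disc_def using form_integral_nonneg[OF B] by simp
    moreover have "(LINT t|time_meas T. ?B (yrb t) (yrb t)) \<noteq> 0"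
      using L2_form_definite[OF B Wd_L2[OF yrb]] nonzero by blast
    ultimately have "(nrmW yrb)\<^sup>2 > 0"
      unfolding nrm_sq using form_integral_nonneg[OF B, of yrb] by linarith
    then have pos: "nrmW yrb > 0" using nrm_nonneg[of yrb] by (cases "nrmW yrb = 0") auto
    have eta: "eta_abs = eta_rel * nrmW yrb / 2"
      unfolding eta_abs_def eta_rel_def using pos \<alpha>(1) by (simp add: \<alpha>_def[symmetric])
    \<comment> \<open>The triangle inequality is obtained from Cauchy-Schwarz: \<open>yrb\<close> is
      tested against itself and split through \<open>e'\<close>, the negative of
      \<open>e\<close>.\<close>
    define e' where "e' = (\<lambda>t. yrb t - yd t)"
    have e': "e' \<in> tensor_space T M N chi \<phi>" unfolding e'_def by (rule Wd_diff[OF yrb yd])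
    have e'_eq: "?b ?B e' w = - ?b ?B e w" if "w \<in> tensor_space T M N chi \<phi>" for w
      unfolding e'_def e_def using that
      by (simp add: b_disc_diff_left[OF B yd yrb] b_disc_diff_left[OF B yrb yd])
    \<comment> \<open>The sign is moved out of each argument in turn, with symmetry in
      between.\<close>
    have "(nrmW e')\<^sup>2 = (nrmW e)\<^sup>2"
      unfolding nrm_sq using e'_eq[OF e'] e'_eq[OF e] b_disc_sym[OF B, of e e'] by simp
    then have nrm_e': "nrmW e' = nrmW e" using nrm_nonneg by (simp add: power2_eq_iff_nonneg)
    have "(nrmW yrb)\<^sup>2 = ?b ?B yd yrb + ?b ?B e' yrb"
      unfolding nrm_sq e'_def b_disc_diff_left[OF B yrb yd yrb] by simp
    also have "\<dots> \<le> nrmW yd * nrmW yrb + nrmW e * nrmW yrb"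
      using CS[OF yd yrb] CS[OF e' yrb] unfolding nrm_e' by (rule add_mono)
    finally have "nrmW yrb \<le> nrmW yd + nrmW e"
      using pos by (simp add: power2_eq_square flip: distrib_right)
    moreover have "eta_rel * nrmW yrb \<le> 1 * nrmW yrb"
      using small pos by (intro mult_right_mono) auto
    \<comment> \<open>With \<open>eta_rel \<le> 1\<close> the error is at most half of
      \<open>nrmW yrb\<close>; this is what the factor 2 in \<open>eta_rel\<close> is for.\<close>
    ultimately have half: "nrmW yrb / 2 \<le> nrmW yd" using abs_bound eta by linarith
    have "eta_rel \<ge> 0"
      unfolding eta_rel_def \<alpha>_def[symmetric] using \<alpha>(1) nrm_nonneg by simp
    then have "eta_rel * (nrmW yrb / 2) \<le> eta_rel * nrmW yd"
      using half by (intro mult_left_mono)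
    then have "nrmW e \<le> eta_rel * nrmW yd" using abs_bound eta by simp
    moreover have "nrmW yd > 0" using half pos by linarith
    ultimately show ?thesis by (simp add: divide_le_eq)
  qed
  ultimately show ?thesis unfolding e_def by blast
qed

end
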